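(* Let $H:[0,\infty)\to(1/2,1)$ be measurable. Then the covariance function $R_H$ has the following equivalent forms. (i) For all $s,t\ge 0$, $$R_H(t,s)=c_{t,s}\left[\tilde\beta_{t,s}\frac{(s\wedge t)^{H_t+H_s}}{H_t+H_s}+\beta^1_{s\wedge t,\,s\vee t}\int_{s\wedge t}^{s\vee t}\int_0^{s\wedge t}\left(\frac yz\right)^{\alpha}(y-z)^{H_t+H_s-2}\,dz\,dy\right],$$ where $\alpha=(H_t-H_s)\mathbf 1_{\{s\le t\}}+(H_s-H_t)\mathbf 1_{\{s>t\}}$. In particular, for $t\ge s\ge 0$, $$R_H(t,s)=c_{t,s}\left[\tilde\beta_{t,s}\frac{s^{H_t+H_s}}{H_t+H_s}+\beta^1_{s,t}\int_s^t\int_0^s\left(\frac yz\right)^{H_t-H_s}(y-z)^{H_t+H_s-2}\,dz\,dy\right].$$ (ii) For $t\ge s\ge 0$ with $t>0$, $$R_H(t,s)=\frac{c_{t,s}}{H_t+H_s}\left[\beta^1_{t,s}\beta^2_{t,s}s^{H_t+H_s}+\beta^1_{s,t}\left(s^{H_t+H_s}\int_{s/t}^1\nu^{-2H_t}(1-\nu)^{H_s+H_t-2}\,d\nu+t^{H_t+H_s}\int_0^{s/t}\nu^{H_s-H_t}(1-\nu)^{H_s+H_t-2}\,d\nu\right)\right],$$ where by convention $0\cdot\infty=0$, and hence $R_H(t,0)=0$. (iii) For $t\ge s>0$, $$R_H(t,s)=\frac{c_{t,s}}{H_t+H_s}\Bigg[\beta^1_{t,s}\beta^2_{t,s}s^{H_t+H_s}+\beta^1_{s,t}\beta^2_{s,t}t^{H_t+H_s}+\frac{\beta^1_{s,t}\,t\,(t-s)^{H_t+H_s-1}}{H_t+H_s-1}\left(\frac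 ts\right)^{H_t-H_s}\Big[{}_2F_1\big(1,2H_t;H_s+H_t;\tfrac{s-t}{s}\big)-{}_2F_1\big(1,H_t-H_s;H_s+H_t;\tfrac{s-t}{s}\big)\Big]\Bigg].$$ (iv) For all $s,t\ge 0$, $$R_H(t,s)=c_{t,s}\int_0^t\int_0^s\Big[\beta^1_{s,t}\mathbf 1_{\{y>z\}}+\beta^1_{t,s}\mathbf 1_{\{y<z\}}\Big]\left(\frac yz\right)^{H_t-H_s}|y-z|^{H_s+H_t-2}\,dz\,dy .$$ (v) For $t\ge s\ge 0$, $$R_H(t,s)=c_{t,s}\left[\frac{\beta^1_{t,s}\beta^2_{t,s}}{H_t+H_s}s^{H_t+H_s}+\frac{\beta^1_{s,t}\beta^2_{s,t}}{H_t+H_s}t^{H_t+H_s}-\beta^1_{s,t}\int_s^t\int_z^t\left(\frac yz\right)^{H_t-H_s}(y-z)^{H_s+H_t-2}\,dy\,dz\right].$$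
   Context: $\beta(\cdot,\cdot)$ denotes the Beta function, and for $h\in(1/2,1)$ set $c_h=\left(\frac{h(2h-1)}{\beta(2-2h,\,h-1/2)}\right)^{1/2}$. For measurable $H:[0,\infty)\to(1/2,1)$ write $H_t=H(t)$ and, for $s,t\ge0$, $$K_H(t,s)=\left[c_{H_t}s^{\frac12-H_t}\int_s^t(u-s)^{H_t-\frac32}u^{H_t-\frac12}\,du\right]\mathbf 1_{[0,t]}(s),\qquad R_H(t,s)=\int_0^{s\wedge t}K_H(t,u)K_H(s,u)\,du .$$ Further set $$c_{t,s}=c_{H_t}c_{H_s},\quad \beta^1_{t,s}=\beta(H_t-1/2,\,2-H_t-H_s),\quad \beta^2_{t,s}=\beta(H_t-H_s+1,\,H_t+H_s-1),\quad \tilde\beta_{t,s}=\beta^1_{t,s}\beta^2_{t,s}+\beta^1_{s,t}\beta^2_{s,t}.$$ ${}_2F_1(a,b;c;z)$ is the Gauss hypergeometric function, given by $\sum_{n\ge0}\frac{(a)_n(b)_n}{(c)_n}\frac{z^n}{n!}$ for $|z|<1$ (with $(x)_0=1$, $(x)_n=x(x+1)\cdots(x+n-1)$) and by analytic continuation (to $\mathbb{C}\setminus[1,\infty)$) otherwise. *)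

theory Defs
  imports "HOL-Complex_Analysis.Complex_Analysis"
begin

definition c_coef :: "real \<Rightarrow> real" where
  "c_coef h = sqrt (h * (2 * h - 1) / Beta (2 - 2 * h) (h - 1 / 2))"

text \<open>All integrals below are Lebesgue integrals over closed intervals. At endpoints where a
  kernel is singular the convention \<open>0 powr x = 0\<close> only affects null sets.\<close>

definition K_H :: "(real \<Rightarrow> real) \<Rightarrow> real \<Rightarrow> real \<Rightarrow> real" where
  "K_H H t s =
     (c_coef (H t) * s powr (1 / 2 - H t) *
       (LBINT u:{s..t}. (u - s) powr (H t - 3 / 2) * u powr (H t - 1 / 2))) * indicator {0..t} s"

definition R_H :: "(real \<Rightarrow> real) \<Rightarrow> real \<Rightarrow> real \<Rightarrow> real" where
  "R_H H t s = (LBINT u:{0..min s t}. K_H H t u * K_H H s u)"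

definition c_prod :: "(real \<Rightarrow> real) \<Rightarrow> real \<Rightarrow> real \<Rightarrow> real" where
  "c_prod H t s = c_coef (H t) * c_coef (H s)"

definition beta1 :: "(real \<Rightarrow> real) \<Rightarrow> real \<Rightarrow> real \<Rightarrow> real" where
  "beta1 H t s = Beta (H t - 1 / 2) (2 - H t - H s)"

definition beta2 :: "(real \<Rightarrow> real) \<Rightarrow> real \<Rightarrow> real \<Rightarrow> real" where
  "beta2 H t s = Beta (H t - H s + 1) (H t + H s - 1)"

definition beta_tilde :: "(real \<Rightarrow> real) \<Rightarrow> real \<Rightarrow> real \<Rightarrow> real" where
  "beta_tilde H t s = beta1 H t s * beta2 H t s + beta1 H s t * beta2 H s t"

text \<open>The Gauss hypergeometric function on the complex plane cut along the real half-line from 1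
  to infinity: the value at \<open>z\<close> of the analytic continuation of the hypergeometric series, which is
  unique because the cut plane is connected. Meaningful when \<open>c\<close> is not a nonpositive integer and
  \<open>z\<close> is off the cut.\<close>

definition hyp2F1 :: "complex \<Rightarrow> complex \<Rightarrow> complex \<Rightarrow> complex \<Rightarrow> complex" where
  "hyp2F1 a b c z =
     (THE w. \<exists>f. f holomorphic_on (- (complex_of_real ` {1..})) \<and>
        (\<forall>x. norm x < 1 \<longrightarrow>
          (\<lambda>n. pochhammer a n * pochhammer b n / pochhammer c n * x ^ n / fact n) sums f x) \<and>
        w = f z)"

end

theory Submission
  imports Defs
begin

text \<open>Fix \<open>s, t\<close> and write \<open>a = H t\<close>, \<open>b = H s\<close>, \<open>c = a + b\<close>, \<open>d = a - b\<close>. All five formulas say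
  how to integrate one function of two variables over the rectangle \<open>[0, t] \<times> [0, s]\<close>.

  Writing both Volterra kernels as integrals and exchanging the order of integration, the covariance
  becomes an integral over \<open>(y, z) \<in> [0, t] \<times> [0, s]\<close> of
  \<open>y^(a-1/2) z^(b-1/2) \<integral>\<^sub>0\<^sup>m u^(1-a-b) (y-u)^(a-3/2) (z-u)^(b-3/2) du\<close> with \<open>m = min y z\<close>.
  The three exponents under the inner integral add up to \<open>-2\<close>, which is exactly what makes a Moebius
  substitution turn it into a Beta integral (\<open>nn_integral_Moebius_Beta\<close>). The result is
  \<open>\<beta>\<^sup>1 (y/z)^d \<bar>y-z\<bar>^(c-2)\<close>, with a different constant \<open>\<beta>\<^sup>1\<close> on each side of the
  diagonal (\<open>nn_integral_covariance\<close>).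
  This is the double integral over the full rectangle.

  The other forms cut the rectangle in different ways, for \<open>s \<le> t\<close>. The power kernel
  \<open>(y/z)^d \<bar>y-z\<bar>^(c-2)\<close> is homogeneous of degree \<open>c - 2\<close>, so its integral over a triangle
  \<open>0 < z < y < s\<close> is a Beta value times \<open>s^c / c\<close>. The square \<open>[0, s]\<^sup>2\<close> consists of two such
  triangles, and what is left is the rectangle \<open>[s, t] \<times> [0, s]\<close>, which gives the first pair of
  formulas. That rectangle is the trapezoid \<open>s < y < t, 0 < z < y\<close> minus the triangle
  \<open>s < z < y < t\<close>, which gives the last one. Substituting \<open>z = v y\<close> in the rectangle and integrating
  over \<open>y\<close> first gives the form with incomplete Beta integrals.

  For the hypergeometric form, \<open>v = 1 - (1-x)(1-w)\<close> with \<open>x = s / t\<close> maps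
  \<open>\<integral>\<^sub>x\<^sup>1 v^(-p) (1-v)^(c-2) dv\<close>, up to a factor, to Euler's integral for \<open>F(1, p; c; 1 - 1/x)\<close>. The hypergeometric function is defined by analytic continuation of its
  series, so Euler's integral has to be shown holomorphic on the whole cut plane. Its weight
  \<open>(c-1)(1-w)^(c-2)\<close> blows up at \<open>w = 1\<close>, but it is a probability density on \<open>[0, 1]\<close>, and
  \<open>r = (1-w)^(c-1)\<close> carries it to the uniform density; what remains is an integral of a
  function that is continuous in both variables and holomorphic in the parameter
  (\<open>hyp2F1_1_eq_integral\<close>).

  Everything but the hypergeometric part concerns nonnegative functions, so the computations use the
  extended nonnegative integral, for which Tonelli's theorem needs no integrability, and are
  translated to Lebesgue integrals of real functions at the end.\<close>

section \<open>Lebesgue integrals of nonnegative functions\<close>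

lemma LBINT_eq_enn2real:
  fixes f :: "real \<Rightarrow> real"
  assumes [measurable]: "f \<in> borel_measurable borel" "A \<in> sets borel"
    and nonneg: "\<And>x. 0 \<le> f x"
  shows "(LBINT x:A. f x) = enn2real (\<integral>\<^sup>+x\<in>A. ennreal (f x) \<partial>lborel)"
proof -
  have "(LBINT x:A. f x) = enn2real (\<integral>\<^sup>+x. ennreal (indicator A x *\<^sub>R f x) \<partial>lborel)"
    unfolding set_lebesgue_integral_def using nonneg
    by (intro integral_eq_nn_integral) auto
  also have "(\<integral>\<^sup>+x. ennreal (indicator A x *\<^sub>R f x) \<partial>lborel) = (\<integral>\<^sup>+x\<in>A. ennreal (f x) \<partial>lborel)"
    by (intro nn_integral_cong) (auto split: split_indicator)
  finally show ?thesis .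
qed

text \<open>An iterated Lebesgue integral of a nonnegative function can go wrong only where an inner integral is
  infinite, since the Lebesgue integral is then \<open>0\<close> by convention. If the iterated
  nonnegative integral is finite, this happens on a null set only.\<close>

lemma LBINT_iterated_eq_enn2real:
  fixes f :: "real \<Rightarrow> real \<Rightarrow> real"
  assumes f [measurable]: "(\<lambda>(x, y). f x y) \<in> borel_measurable (borel \<Otimes>\<^sub>M borel)"
    and A [measurable]: "A \<in> sets borel"
    and B [measurable]: "Measurable.pred (borel \<Otimes>\<^sub>M borel) (\<lambda>(x, y). y \<in> B x)"
    and nonneg: "\<And>x y. 0 \<le> f x y"
    and finite: "(\<integral>\<^sup>+x\<in>A. (\<integral>\<^sup>+y\<in>B x. ennreal (f x y) \<partial>lborel) \<partial>lborel) < \<infinity>"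
  shows "(LBINT x:A. LBINT y:B x. f x y) =
    enn2real (\<integral>\<^sup>+x\<in>A. (\<integral>\<^sup>+y\<in>B x. ennreal (f x y) \<partial>lborel) \<partial>lborel)"
proof -
  have B': "B x \<in> sets borel" for x
  proof -
    have "Measurable.pred borel (\<lambda>y. y \<in> B x)"
      using measurable_compose[OF measurable_Pair1' B, of x] by simp
    then show ?thesis
      by (simp add: pred_def)
  qed
  have f': "f x \<in> borel_measurable borel" for x
    using measurable_compose[OF measurable_Pair1' f, of x] by simp
  define I where "I = (\<lambda>x. \<integral>\<^sup>+y\<in>B x. ennreal (f x y) \<partial>lborel)"
  have [measurable]: "I \<in> borel_measurable borel"
    unfolding I_def by measurable
  have inner: "(LBINT y:B x. f x y) = enn2real (I x)" for x
    unfolding I_def by (rule LBINT_eq_enn2real[OF f' B' nonneg])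
  have "(LBINT x:A. enn2real (I x)) = enn2real (\<integral>\<^sup>+x\<in>A. ennreal (enn2real (I x)) \<partial>lborel)"
    by (rule LBINT_eq_enn2real) auto
  also have "(\<integral>\<^sup>+x\<in>A. ennreal (enn2real (I x)) \<partial>lborel) = (\<integral>\<^sup>+x\<in>A. I x \<partial>lborel)"
  proof (rule nn_integral_cong_AE)
    have "(\<integral>\<^sup>+x\<in>A. I x \<partial>lborel) \<noteq> \<infinity>"
      unfolding I_def using finite by (rule less_imp_neq)
    then have "AE x in lborel. I x * indicator A x \<noteq> \<infinity>"
      by (rule nn_integral_PInf_AE[rotated]) measurable
    then show "AE x in lborel. ennreal (enn2real (I x)) * indicator A x = I x * indicator A x"
      by eventually_elim (auto split: split_indicator simp: less_top ennreal_enn2real)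
  qed
  finally show ?thesis
    unfolding inner I_def .
qed

lemma LBINT_singleton: "(LBINT x:{a}. f x :: real) = 0"
  unfolding set_lebesgue_integral_def
proof (rule integral_eq_zero_AE)
  show "AE x in lborel. indicator {a} x *\<^sub>R f x = 0"
    using AE_lborel_singleton[of a] by eventually_elim simp
qed

lemma LBINT_eq_of_has_integral:
  fixes f :: "real \<Rightarrow> real"
  assumes "f \<in> borel_measurable borel" "A \<in> sets borel" "\<And>x. 0 \<le> f x" and I: "(f has_integral I) A"
  shows "(LBINT x:A. f x) = I"
proof -
  have "0 \<le> I"
    using assms(3) by (intro has_integral_nonneg[OF I])
  then show ?thesis
    using assms by (simp add: LBINT_eq_enn2real nn_integral_has_integral_lebesgue'[OF _ I])
qed

text \<open>Makes indicators of intervals with variable endpoints accessible to the measurability prover.\<close>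

lemma pred_in_Icc [measurable (raw)]:
  fixes f g h :: "'a \<Rightarrow> real"
  assumes [measurable]: "f \<in> borel_measurable M" "g \<in> borel_measurable M" "h \<in> borel_measurable M"
  shows "Measurable.pred M (\<lambda>x. f x \<in> {g x..h x})"
  unfolding atLeastAtMost_iff by measurable

lemma nn_integral_split_interval:
  fixes f :: "real \<Rightarrow> ennreal"
  assumes [measurable]: "f \<in> borel_measurable borel" and "a \<le> b" "b \<le> c"
  shows "(\<integral>\<^sup>+x\<in>{a..c}. f x \<partial>lborel) = (\<integral>\<^sup>+x\<in>{a..b}. f x \<partial>lborel) + (\<integral>\<^sup>+x\<in>{b..c}. f x \<partial>lborel)"
proof -
  have "(\<integral>\<^sup>+x\<in>{a..c}. f x \<partial>lborel) = (\<integral>\<^sup>+x. f x * indicator {a..b} x + f x * indicator {b..c} x \<partial>lborel)"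
  proof (rule nn_integral_cong_AE)
    show "AE x in lborel. f x * indicator {a..c} x = f x * indicator {a..b} x + f x * indicator {b..c} x"
      using AE_lborel_singleton[of b]
      by eventually_elim (use assms in \<open>auto split: split_indicator\<close>)
  qed
  also have "\<dots> = (\<integral>\<^sup>+x\<in>{a..b}. f x \<partial>lborel) + (\<integral>\<^sup>+x\<in>{b..c}. f x \<partial>lborel)"
    by (rule nn_integral_add) measurable
  finally show ?thesis .
qed

lemma nn_integral_triangle_swap:
  fixes F :: "real \<Rightarrow> real \<Rightarrow> ennreal"
  assumes [measurable]: "(\<lambda>(y, z). F y z) \<in> borel_measurable (borel \<Otimes>\<^sub>M borel)"
  shows "(\<integral>\<^sup>+y\<in>{s..t}. (\<integral>\<^sup>+z\<in>{s..y}. F y z \<partial>lborel) \<partial>lborel) =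
    (\<integral>\<^sup>+z\<in>{s..t}. (\<integral>\<^sup>+y\<in>{z..t}. F y z \<partial>lborel) \<partial>lborel)"
proof -
  define G where "G = (\<lambda>y z. F y z * of_bool (s \<le> z \<and> z \<le> y \<and> y \<le> t))"
  have G_measurable: "(\<lambda>(y, z). G y z) \<in> borel_measurable (lborel \<Otimes>\<^sub>M lborel)"
    unfolding G_def of_bool_def by measurable
  have "(\<integral>\<^sup>+y\<in>{s..t}. (\<integral>\<^sup>+z\<in>{s..y}. F y z \<partial>lborel) \<partial>lborel) = (\<integral>\<^sup>+y. \<integral>\<^sup>+z. G y z \<partial>lborel \<partial>lborel)"
  proof (rule nn_integral_cong)
    show "(\<integral>\<^sup>+z\<in>{s..y}. F y z \<partial>lborel) * indicator {s..t} y = (\<integral>\<^sup>+z. G y z \<partial>lborel)" for y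
    proof (cases "y \<in> {s..t}")
      case True
      then show ?thesis
        by (auto intro!: nn_integral_cong simp: G_def split: split_indicator)
    next
      case False
      then have "G y z = 0" for z
        by (auto simp: G_def)
      then show ?thesis
        using False by simp
    qed
  qed
  also have "\<dots> = (\<integral>\<^sup>+z. \<integral>\<^sup>+y. G y z \<partial>lborel \<partial>lborel)"
    by (rule lborel_pair.Fubini'[OF G_measurable, symmetric])
  also have "\<dots> = (\<integral>\<^sup>+z\<in>{s..t}. (\<integral>\<^sup>+y\<in>{z..t}. F y z \<partial>lborel) \<partial>lborel)"
  proof (rule nn_integral_cong)
    show "(\<integral>\<^sup>+y. G y z \<partial>lborel) = (\<integral>\<^sup>+y\<in>{z..t}. F y z \<partial>lborel) * indicator {s..t} z" for z
    proof (cases "z \<in> {s..t}")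
      case True
      then show ?thesis
        by (auto intro!: nn_integral_cong simp: G_def split: split_indicator)
    next
      case False
      then have "G y z = 0" for y
        by (auto simp: G_def)
      then show ?thesis
        using False by simp
    qed
  qed
  finally show ?thesis .
qed

lemma nn_integral_Beta:
  fixes a b :: real
  assumes "0 < a" "0 < b"
  shows "(\<integral>\<^sup>+v\<in>{0..1}. ennreal (v powr (a - 1) * (1 - v) powr (b - 1)) \<partial>lborel) = ennreal (Beta a b)"
  by (intro nn_integral_has_integral_lebesgue' has_integral_Beta_real assms) auto

lemma Beta_pos: "0 < a \<Longrightarrow> 0 < b \<Longrightarrow> 0 < Beta a (b :: real)"
  by (simp add: Beta_def)

lemma nn_integral_powr_shifted:
  fixes p u s t :: real
  assumes "0 < p" "u \<le> s" "s \<le> t"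
  shows "(\<integral>\<^sup>+y\<in>{s..t}. ennreal ((y - u) powr (p - 1)) \<partial>lborel) =
    ennreal (((t - u) powr p - (s - u) powr p) / p)"
proof (intro nn_integral_has_integral_lebesgue')
  have "((\<lambda>y. (y - u) powr (p - 1)) has_integral (t - u) powr p / p - (s - u) powr p / p) {s..t}"
  proof (rule fundamental_theorem_of_calculus_interior)
    show "continuous_on {s..t} (\<lambda>y. (y - u) powr p / p)"
      using assms by (intro continuous_intros continuous_on_powr') auto
    show "((\<lambda>y. (y - u) powr p / p) has_vector_derivative (y - u) powr (p - 1)) (at y)"
      if "y \<in> {s<..<t}" for y
      using that assms unfolding has_real_derivative_iff_has_vector_derivative[symmetric]
      by (auto intro!: derivative_eq_intros)
  qed (use assms in auto)
  then show "((\<lambda>y. (y - u) powr (p - 1)) has_integral ((t - u) powr p - (s - u) powr p) / p) {s..t}"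
    by (simp add: diff_divide_distrib)
qed auto

section \<open>The Gauss hypergeometric function with first parameter 1\<close>

text \<open>The cut plane is star-shaped, hence connected, so the analytic continuation of the series from the
  unit disk is unique, and any holomorphic function that agrees with the series there computes
  \<open>hyp2F1\<close>.\<close>

lemma hyp2F1_eqI:
  assumes hol: "f holomorphic_on - (complex_of_real ` {1..})"
    and ser: "\<And>x. norm x < 1 \<Longrightarrow>
      (\<lambda>n. pochhammer a n * pochhammer b n / pochhammer c n * x ^ n / fact n) sums f x"
    and z: "z \<notin> complex_of_real ` {1..}"
  shows "hyp2F1 a b c z = f z"
  unfolding hyp2F1_def
proof (rule the_equality)
  show "\<exists>g. g holomorphic_on - (complex_of_real ` {1..}) \<and>
        (\<forall>x. norm x < 1 \<longrightarrow>
          (\<lambda>n. pochhammer a n * pochhammer b n / pochhammer c n * x ^ n / fact n) sums g x) \<and>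
        f z = g z"
    using hol ser by blast
next
  fix w
  assume "\<exists>g. g holomorphic_on - (complex_of_real ` {1..}) \<and>
        (\<forall>x. norm x < 1 \<longrightarrow>
          (\<lambda>n. pochhammer a n * pochhammer b n / pochhammer c n * x ^ n / fact n) sums g x) \<and>
        w = g z"
  then obtain g where g: "g holomorphic_on - (complex_of_real ` {1..})" "w = g z"
    "\<And>x. norm x < 1 \<Longrightarrow>
      (\<lambda>n. pochhammer a n * pochhammer b n / pochhammer c n * x ^ n / fact n) sums g x"
    by blast
  have disk: "ball 0 1 \<subseteq> - (complex_of_real ` {1..})"
    by auto
  have "f z = g z"
  proof (rule analytic_continuation_open[OF open_ball _ _ _ disk hol g(1)])
    show "open (- (complex_of_real ` {1..}))"
      by (intro open_Compl closed_slot_right)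
    show "connected (- (complex_of_real ` {1..}))"
      by (intro starlike_imp_connected starlike_slotted_complex_plane_right)
    show "f x = g x" if "x \<in> ball 0 1" for x
      using that ser[of x] g(3)[of x] sums_unique2 by auto
  qed (use z in auto)
  then show "w = f z"
    using g(2) by simp
qed

text \<open>The substitution \<open>v = 1 - (1-x) r^(1/(c-1))\<close> absorbs the singular weight \<open>(1-v)^(c-2)\<close>: its Jacobian
  cancels the weight up to the constant \<open>(1-x)^(c-1) / (c-1)\<close>. The change of variables is carried out
  on the open interval, where the substitution is differentiable.\<close>

lemma integral_singular_endpoint:
  fixes F :: "real \<Rightarrow> real"
  assumes c: "1 < c" and x: "x < 1" and F: "continuous_on {x..1} F"
  shows "((\<lambda>v. F v * (1 - v) powr (c - 2)) has_integral
          (1 - x) powr (c - 1) / (c - 1) *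
            integral {0..1} (\<lambda>r. F (1 - (1 - x) * r powr (1 / (c - 1))))) {x..1}"
proof -
  \<comment> \<open>the exponent for which the power \<open>q - 1 + q (c - 2)\<close> of \<open>r\<close> after the substitution vanishes\<close>
  define q where "q = 1 / (c - 1)"
  have q: "0 < q" "q * (c - 1) = 1"
    using c by (auto simp: q_def)
  let ?g = "\<lambda>r. 1 - (1 - x) * r powr q"
  let ?g' = "\<lambda>r. - ((1 - x) * (q * r powr (q - 1)))"
  let ?h = "\<lambda>r. (1 - x) powr (c - 1) * q * F (?g r)"
  have g_range: "?g r \<in> {x..1}" if "r \<in> {0..1}" for r
  proof -
    define m where "m = (1 - x) * r powr q"
    have "m \<le> 1 - x"
      unfolding m_def using that q x by (intro mult_left_le) (auto simp: powr_le1)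
    moreover have "0 \<le> m"
      using x by (simp add: m_def)
    ultimately show ?thesis
      unfolding m_def[symmetric] by simp
  qed
  have "continuous_on {0..1} ?g"
    using q(1) by (intro continuous_intros continuous_on_powr') auto
  then have "continuous_on {0..1} (\<lambda>r. F (?g r))"
    using g_range by (intro continuous_on_compose2[OF F]) auto
  then have "continuous_on {0..1} ?h"
    by (rule continuous_on_mult_left)
  then have h_int: "?h absolutely_integrable_on {0..1}"
    by (rule absolutely_integrable_continuous_real)
  have image: "?g ` {0<..<1} = {x<..<1}"
  proof (intro equalityI subsetI)
    fix v assume "v \<in> ?g ` {0<..<1}"
    then obtain r where r: "0 < r" "r < 1" "v = ?g r"
      by auto
    define m where "m = (1 - x) * r powr q"
    have "r powr q < 1"
      using r q powr_less_mono2[of q r 1] by simp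
    then have "(1 - x) * r powr q < (1 - x) * 1"
      using x by (intro mult_strict_left_mono) auto
    then have "m < 1 - x" "0 < m"
      using x r by (auto simp: m_def)
    then show "v \<in> {x<..<1}"
      unfolding r(3) m_def[symmetric] by simp
  next
    fix v assume v: "v \<in> {x<..<1}"
    let ?r = "((1 - v) / (1 - x)) powr (c - 1)"
    have "?r powr q = (1 - v) / (1 - x)"
      using v x q by (simp add: powr_powr mult.commute)
    then have "v = ?g ?r"
      using x by simp
    moreover have "?r \<in> {0<..<1}"
      using v x c powr_less_mono2[of "c - 1" "(1 - v) / (1 - x)" 1] by auto
    ultimately show "v \<in> ?g ` {0<..<1}"
      by blast
  qed
  have inj: "inj_on ?g {0<..<1}"
  proof (rule inj_onI)
    fix r s :: real assume rs: "r \<in> {0<..<1}" "s \<in> {0<..<1}" "?g r = ?g s"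
    then have "r powr q = s powr q"
      using x by auto
    then have "(r powr q) powr (c - 1) = (s powr q) powr (c - 1)"
      by simp
    then show "r = s"
      using rs q by (simp add: powr_powr)
  qed
  have h_eq: "\<bar>?g' r\<bar> * (F (?g r) * (1 - ?g r) powr (c - 2)) = ?h r" if r: "r \<in> {0<..<1}" for r
  proof -
    have B: "(1 - ?g r) powr (c - 2) = (1 - x) powr (c - 2) * r powr (q * (c - 2))"
      using x r by (simp add: powr_mult powr_powr)
    have AC: "r powr (q - 1) * r powr (q * (c - 2)) = 1"
    proof -
      have "q - 1 + q * (c - 2) = 0"
        using q(2) by (simp add: algebra_simps)
      then show ?thesis
        using r by (simp flip: powr_add)
    qed
    have D: "(1 - x) * (1 - x) powr (c - 2) = (1 - x) powr (c - 1)"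
      using x powr_add[of "1 - x" 1 "c - 2"] by simp
    have A: "\<bar>?g' r\<bar> = (1 - x) * (q * r powr (q - 1))"
      using x q by (simp add: abs_mult)
    have "x' * (q * a) * (f * (b * d)) = (x' * b) * q * f * (a * d)" for x' a b d f :: real
      by (simp add: mult_ac)
    then show ?thesis
      unfolding A B by (simp only: AC D mult_1_right)
  qed
  have "(\<lambda>v. F v * (1 - v) powr (c - 2)) absolutely_integrable_on (?g ` {0<..<1}) \<and>
        integral (?g ` {0<..<1}) (\<lambda>v. F v * (1 - v) powr (c - 2)) = integral {0..1} ?h"
  proof (subst has_absolute_integral_change_of_variables_1'[symmetric])
    show "{0<..<1::real} \<in> sets lebesgue"
      by auto
    show "(?g has_field_derivative ?g' r) (at r within {0<..<1})" if "r \<in> {0<..<1}" for r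
      using that by (auto intro!: derivative_eq_intros)
    have "?h absolutely_integrable_on {0<..<1} \<and> integral {0<..<1} ?h = integral {0..1} ?h"
      using h_int by (auto simp: absolutely_integrable_on_Icc_iff_Ioo integral_open_interval_real
          intro: set_integrable_subset)
    moreover have "(\<lambda>r. \<bar>?g' r\<bar> * (F (?g r) * (1 - ?g r) powr (c - 2))) absolutely_integrable_on {0<..<1}
        \<longleftrightarrow> ?h absolutely_integrable_on {0<..<1}"
      using h_eq by (intro set_integrable_cong) auto
    moreover have "integral {0<..<1} (\<lambda>r. \<bar>?g' r\<bar> * (F (?g r) * (1 - ?g r) powr (c - 2)))
        = integral {0<..<1} ?h"
      using h_eq by (intro integral_cong) auto
    ultimately show "(\<lambda>r. \<bar>?g' r\<bar> * (F (?g r) * (1 - ?g r) powr (c - 2))) absolutely_integrable_on {0<..<1} \<and>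
       integral {0<..<1} (\<lambda>r. \<bar>?g' r\<bar> * (F (?g r) * (1 - ?g r) powr (c - 2))) = integral {0..1} ?h"
      by simp
  qed (rule inj)
  then have "((\<lambda>v. F v * (1 - v) powr (c - 2)) has_integral integral {0..1} ?h) {x<..<1}"
    unfolding image absolutely_integrable_on_def by (metis integrable_integral)
  then show ?thesis
    by (simp add: has_integral_Icc_iff_Ioo q_def)
qed

text \<open>The moments of \<open>1 - r^(1/(c-1))\<close> under the uniform distribution are Beta values. They are the
  coefficients that turn the binomial series of \<open>(1-z)^(-p)\<close> into the hypergeometric series.\<close>

lemma integral_one_minus_powr_power:
  fixes c :: real
  assumes c: "1 < c"
  shows "integral {0..1} (\<lambda>r. (1 - r powr (1 / (c - 1))) ^ n) = fact n / pochhammer c n"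
proof -
  let ?I = "integral {0..1} (\<lambda>r. (1 - r powr (1 / (c - 1))) ^ n)"
  have "((\<lambda>v. v ^ n * (1 - v) powr (c - 2)) has_integral 1 / (c - 1) * ?I) {0<..<1}"
    using integral_singular_endpoint[of c 0 "\<lambda>v. v ^ n"] c
    by (simp add: has_integral_Icc_iff_Ioo continuous_intros)
  moreover have "((\<lambda>v. v ^ n * (1 - v) powr (c - 2)) has_integral Beta (real n + 1) (c - 1)) {0<..<1}"
  proof -
    have "((\<lambda>v. v powr (real n + 1 - 1) * (1 - v) powr (c - 1 - 1)) has_integral
            Beta (real n + 1) (c - 1)) {0<..<1}"
      using has_integral_Beta_real[of "real n + 1" "c - 1"] c by (simp add: has_integral_Icc_iff_Ioo)
    then show ?thesis
      by (rule has_integral_cong[THEN iffD1, rotated]) (auto simp: powr_realpow)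
  qed
  ultimately have "1 / (c - 1) * ?I = Beta (real n + 1) (c - 1)"
    by (rule has_integral_unique)
  then have "?I = (c - 1) * Beta (real n + 1) (c - 1)"
    using c by (simp add: field_simps)
  also have "\<dots> = Gamma (real n + 1) * (((c - 1) * Gamma (c - 1)) / Gamma (real n + c))"
    by (simp add: Beta_def)
  also have "(c - 1) * Gamma (c - 1) = Gamma c"
    using c Gamma_plus1[of "c - 1"] nonpos_Ints_subset_nonpos_Reals by (force elim!: nonpos_Ints_cases)
  also have "Gamma (real n + 1) = fact n"
    by (metis Gamma_fact add.commute of_nat_Suc)
  also have "Gamma c / Gamma (real n + c) = 1 / pochhammer c n"
    using c pochhammer_Gamma[of c n] by (force elim!: nonpos_Ints_cases simp: add.commute)
  finally show ?thesis
    by simp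
qed

text \<open>If \<open>z\<close> is off the cut \<open>[1, \<infinity>)\<close> and \<open>0 \<le> g \<le> 1\<close>, then \<open>1 - z g\<close> is off the cut of the principal
  power. So differentiation under the integral sign is possible, on every ball inside the cut plane.\<close>

lemma holomorphic_on_regularised_Euler_integral:
  fixes p :: complex and g :: "real \<Rightarrow> real"
  assumes g: "continuous_on {0..1} g" "\<And>r. r \<in> {0..1} \<Longrightarrow> g r \<in> {0..1}"
  shows "(\<lambda>z. integral {0..1} (\<lambda>r. (1 - z * of_real (g r)) powr p)) holomorphic_on
           - (complex_of_real ` {1..})"
proof -
  let ?S = "- (complex_of_real ` {1..})"
  have op: "open ?S"
    by (intro open_Compl closed_slot_right)
  have off_cut: "1 - z * of_real (g r) \<notin> \<real>\<^sub>\<le>\<^sub>0" if z: "z \<in> ?S" and r: "r \<in> {0..1}" for z r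
  proof
    assume "1 - z * of_real (g r) \<in> \<real>\<^sub>\<le>\<^sub>0"
    then obtain x where x: "1 - z * of_real (g r) = of_real x" "x \<le> 0"
      by (auto elim!: nonpos_Reals_cases)
    have gr: "0 \<le> g r" "g r \<le> 1"
      using g(2)[OF r] by auto
    have zg: "z * of_real (g r) = of_real (1 - x)"
      using x(1) by (simp add: algebra_simps)
    then have "g r \<noteq> 0"
      using x(2) by (auto simp del: of_real_diff)
    then have "z = of_real ((1 - x) / g r)" "1 \<le> (1 - x) / g r"
      using zg gr x(2) by (auto simp: field_simps)
    then show False
      using z by (metis ComplD atLeast_iff image_eqI)
  qed
  have half_plane: "w \<in> {w. 0 \<le> Re w \<or> Im w \<noteq> 0} - {0}" if "w \<notin> \<real>\<^sub>\<le>\<^sub>0" for w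
    using that by (auto simp: complex_nonpos_Reals_iff)
  have "(\<lambda>z. integral {0..1} (\<lambda>r. (1 - z * of_real (g r)) powr p)) holomorphic_on ball w e"
    if ball: "ball w e \<subseteq> ?S" for w e
  proof -
    have "(\<lambda>z. integral (cbox 0 1) (\<lambda>r. (1 - z * of_real (g r)) powr p)) holomorphic_on ball w e"
    proof (rule leibniz_rule_holomorphic)
      show "((\<lambda>z. (1 - z * of_real (g r)) powr p) has_field_derivative
              p * (1 - z * of_real (g r)) powr (p - 1) * (- of_real (g r))) (at z within ball w e)"
        if "z \<in> ball w e" "r \<in> cbox 0 1" for z r
        using off_cut[of z r] that ball
        by (auto intro!: derivative_eq_intros simp: subset_iff)
      show "(\<lambda>r. (1 - z * of_real (g r)) powr p) integrable_on cbox 0 1" if "z \<in> ball w e" for z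
      proof (intro integrable_continuous continuous_on_powr_complex continuous_intros)
        have "1 - z * of_real (g r) \<in> {w. 0 \<le> Re w \<or> Im w \<noteq> 0} - {0}" if "r \<in> cbox 0 1" for r
          using \<open>z \<in> ball w e\<close> that ball by (intro half_plane off_cut) auto
        then show "cbox 0 1 \<subseteq> {r. 0 \<le> Re (1 - z * of_real (g r)) \<or> Im (1 - z * of_real (g r)) \<noteq> 0}"
          and "\<And>r. r \<in> cbox 0 1 \<Longrightarrow> 1 - z * of_real (g r) = 0 \<Longrightarrow> 0 < Re p"
          by blast+
      qed (use g(1) in auto)
      show "continuous_on (ball w e \<times> cbox 0 1)
          (\<lambda>(z, r). p * (1 - z * of_real (g r)) powr (p - 1) * - of_real (g r))"
      proof -
        have gs: "continuous_on (ball w e \<times> cbox 0 1) (\<lambda>y. g (snd y))"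
          by (intro continuous_intros continuous_on_compose2[OF g(1)]) auto
        have "1 - fst y * of_real (g (snd y)) \<in> {w. 0 \<le> Re w \<or> Im w \<noteq> 0} - {0}"
          if "y \<in> ball w e \<times> cbox 0 1" for y
          using that ball by (intro half_plane off_cut) auto
        then have "continuous_on (ball w e \<times> cbox 0 1)
            (\<lambda>y. (1 - fst y * of_real (g (snd y))) powr (p - 1))"
          by (intro continuous_on_powr_complex continuous_intros gs) blast+
        then show ?thesis
          unfolding split_beta by (intro continuous_on_mult continuous_on_minus continuous_on_of_real continuous_on_const gs)
      qed
    qed auto
    then show ?thesis
      by simp
  qed
  then show ?thesis
    unfolding analytic_on_open[OF op, symmetric] analytic_on_def
    using op unfolding open_contains_ball by meson
qed

lemma binomial_series_pochhammer:
  fixes p z :: complex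
  assumes "norm z < 1"
  shows "(\<lambda>n. pochhammer p n / fact n * z ^ n) sums (1 - z) powr (- p)"
    and "summable (\<lambda>n. norm (pochhammer p n / fact n * z ^ n))"
proof -
  have sums: "(\<lambda>n. pochhammer p n / fact n * w ^ n) sums (1 - w) powr (- p)" if "norm w < 1" for w
  proof -
    have "(- p gchoose n) * (- w) ^ n = pochhammer p n / fact n * w ^ n" for n
      by (simp add: gbinomial_pochhammer power_minus[of w])
    then show ?thesis
      using gen_binomial_complex[of "- w" "- p"] that by simp
  qed
  then show "(\<lambda>n. pochhammer p n / fact n * z ^ n) sums (1 - z) powr (- p)"
    using assms by blast
  \<comment> \<open>convergence at a point of larger modulus gives absolute convergence at \<open>z\<close>\<close>
  define R where "R = (1 + norm z) / 2"
  have "norm z < R" "R < 1"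
    using assms by (auto simp: R_def)
  then show "summable (\<lambda>n. norm (pochhammer p n / fact n * z ^ n))"
    using sums_summable[OF sums[of "of_real R"]] norm_ge_zero[of z]
    by (intro powser_insidea[where x = "of_real R"]) auto
qed

text \<open>Expanding the integrand in the binomial series and integrating term by term, which is legitimate
  because the series converges uniformly in \<open>r\<close>, gives the hypergeometric series on the unit disk. The
  integral is holomorphic on the cut plane, hence it is the continuation.\<close>

lemma hyp2F1_1_eq_integral:
  fixes p z c :: real
  assumes c: "1 < c" and z: "z < 1"
  shows "hyp2F1 1 (of_real p) (of_real c) (of_real z) =
    of_real (integral {0..1} (\<lambda>r. (1 - z * (1 - r powr (1 / (c - 1)))) powr (- p)))"
proof -
  define g where "g = (\<lambda>r::real. 1 - r powr (1 / (c - 1)))"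
  have g_cont: "continuous_on {0..1} g"
    unfolding g_def using c by (intro continuous_intros continuous_on_powr') auto
  have g_range: "g r \<in> {0..1}" if "r \<in> {0..1}" for r
    using that c by (auto simp: g_def powr_le1)
  let ?f = "\<lambda>z. integral {0..1} (\<lambda>r. (1 - z * of_real (g r)) powr (- complex_of_real p))"
  have "hyp2F1 1 (of_real p) (of_real c) (of_real z) = ?f (of_real z)"
  proof (rule hyp2F1_eqI)
    show "?f holomorphic_on - (complex_of_real ` {1..})"
      by (rule holomorphic_on_regularised_Euler_integral[OF g_cont g_range])
    show "complex_of_real z \<notin> complex_of_real ` {1..}"
      using z by auto
    fix x :: complex
    assume x: "norm x < 1"
    let ?a = "\<lambda>n. pochhammer (complex_of_real p) n / fact n"
    have small: "norm (x * of_real (g r)) < 1" "norm (x * of_real (g r)) \<le> norm x"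
      if "r \<in> {0..1}" for r
    proof -
      show "norm (x * of_real (g r)) \<le> norm x"
        using g_range[OF that] mult_left_mono[of "g r" 1 "norm x"] by (simp add: norm_mult)
      then show "norm (x * of_real (g r)) < 1"
        using x by simp
    qed
    have "uniform_limit {0..1} (\<lambda>m r. \<Sum>n<m. ?a n * (x * of_real (g r)) ^ n)
            (\<lambda>r. \<Sum>n. ?a n * (x * of_real (g r)) ^ n) sequentially"
    proof (rule Weierstrass_m_test[OF _ binomial_series_pochhammer(2)[OF x]])
      show "norm (?a n * (x * of_real (g r)) ^ n) \<le> norm (?a n * x ^ n)" if "r \<in> {0..1}" for n r
        unfolding norm_mult[of "?a n"] norm_power
        using small(2)[OF that] by (intro mult_left_mono power_mono) auto
    qed
    moreover have "(\<Sum>n. ?a n * (x * of_real (g r)) ^ n) = (1 - x * of_real (g r)) powr (- of_real p)"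
      if "r \<in> {0..1}" for r
      using binomial_series_pochhammer(1)[OF small(1)[OF that]] by (simp add: sums_iff)
    ultimately have unif: "uniform_limit {0..1} (\<lambda>m r. \<Sum>n<m. ?a n * (x * of_real (g r)) ^ n)
            (\<lambda>r. (1 - x * of_real (g r)) powr (- of_real p)) sequentially"
      by (rule uniform_limit_cong'[THEN iffD1, rotated -1, OF _ refl]) 
    have cont: "continuous_on {0..1} (\<lambda>r. \<Sum>n<m. ?a n * (x * of_real (g r)) ^ n)" for m
      by (intro continuous_intros g_cont)
    obtain I J where I: "\<And>m. ((\<lambda>r. \<Sum>n<m. ?a n * (x * of_real (g r)) ^ n) has_integral I m) {0..1}"
      and J: "((\<lambda>r. (1 - x * of_real (g r)) powr (- of_real p)) has_integral J) {0..1}"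
      and lim: "I \<longlonglongrightarrow> J"
      by (rule uniform_limit_integral[OF unif cont sequentially_bot]) (rule that)
    have "I m = (\<Sum>n<m. pochhammer 1 n * pochhammer (of_real p) n / pochhammer (of_real c) n * x ^ n / fact n)" for m
    proof (rule has_integral_unique[OF I])
      have "((\<lambda>r. ?a n * (x * of_real (g r)) ^ n) has_integral
          pochhammer 1 n * pochhammer (of_real p) n / pochhammer (of_real c) n * x ^ n / fact n) {0..1}" for n
      proof -
        have "((\<lambda>r. g r ^ n) has_integral fact n / pochhammer c n) {0..1}"
        proof -
          have "(\<lambda>r. g r ^ n) integrable_on {0..1}"
            by (intro integrable_continuous_real continuous_intros g_cont)
          moreover have "integral {0..1} (\<lambda>r. g r ^ n) = fact n / pochhammer c n"
            unfolding g_def by (rule integral_one_minus_powr_power[OF c])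
          ultimately show ?thesis
            by (simp only: has_integral_integrable_integral)
        qed
        from has_integral_mult_right[OF has_integral_of_real[OF this], of "?a n * x ^ n"]
        have "((\<lambda>r. ?a n * x ^ n * of_real (g r ^ n)) has_integral
            ?a n * x ^ n * of_real (fact n / pochhammer c n)) {0..1}" .
        moreover have "pochhammer (1 :: complex) n = fact n"
          by (rule pochhammer_fact[symmetric])
        then have "?a n * x ^ n * of_real (fact n / pochhammer c n) =
            pochhammer 1 n * pochhammer (of_real p) n / pochhammer (of_real c) n * x ^ n / fact n"
          by (simp only: pochhammer_of_real of_real_divide of_real_fact) simp
        ultimately show ?thesis
          by (simp only: power_mult_distrib of_real_power mult.assoc)
      qed
      then show "((\<lambda>r. \<Sum>n<m. ?a n * (x * of_real (g r)) ^ n) has_integral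
          (\<Sum>n<m. pochhammer 1 n * pochhammer (of_real p) n / pochhammer (of_real c) n * x ^ n / fact n)) {0..1}"
        by (intro has_integral_sum) auto
    qed
    then have "I = (\<lambda>m. \<Sum>n<m. pochhammer 1 n * pochhammer (of_real p) n / pochhammer (of_real c) n * x ^ n / fact n)"
      by (rule ext)
    then show "(\<lambda>n. pochhammer 1 n * pochhammer (of_real p) n / pochhammer (of_real c) n * x ^ n / fact n) sums ?f x"
      using lim unfolding sums_def integral_unique[OF J] by simp
  qed
  also have "?f (of_real z) = of_real (integral {0..1} (\<lambda>r. (1 - z * g r) powr (- p)))"
  proof (rule integral_unique)
    have pos: "0 < 1 - z * g r" if "r \<in> {0..1}" for r
    proof -
      have "z * g r < 1"
      proof (cases "0 \<le> z")
        case True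
        then have "z * g r \<le> z"
          using g_range[OF that] by (intro mult_left_le) auto
        then show ?thesis
          using z by simp
      next
        case False
        then have "z * g r \<le> 0"
          using g_range[OF that] by (intro mult_nonpos_nonneg) auto
        then show ?thesis
          by simp
      qed
      then show ?thesis
        by simp
    qed
    have "((\<lambda>r. (1 - z * g r) powr (- p)) has_integral integral {0..1} (\<lambda>r. (1 - z * g r) powr (- p))) {0..1}"
      using pos by (intro integrable_integral integrable_continuous_real continuous_intros g_cont) (metis less_irrefl)
    from has_integral_of_real[OF this]
    have "((\<lambda>r. complex_of_real ((1 - z * g r) powr (- p))) has_integral
       of_real (integral {0..1} (\<lambda>r. (1 - z * g r) powr (- p)))) {0..1}" .
    then show "((\<lambda>r. (1 - of_real z * of_real (g r)) powr (- complex_of_real p)) has_integral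
       of_real (integral {0..1} (\<lambda>r. (1 - z * g r) powr (- p)))) {0..1}"
    proof (rule has_integral_cong[THEN iffD1, rotated])
      show "complex_of_real ((1 - z * g r) powr (- p)) =
         (1 - of_real z * of_real (g r)) powr (- complex_of_real p)" if "r \<in> {0..1}" for r
        using powr_of_real[of "1 - z * g r" "- p"] pos[OF that] by simp
    qed
  qed
  finally show ?thesis
    by (simp add: g_def)
qed

lemma incomplete_Beta_eq_hyp2F1:
  fixes x c p :: real
  assumes c: "1 < c" and x: "0 < x" "x \<le> 1"
  obtains F where "hyp2F1 1 (of_real p) (of_real c) (of_real (1 - 1 / x)) = of_real F"
    and "((\<lambda>v. v powr (- p) * (1 - v) powr (c - 2)) has_integral
          (1 - x) powr (c - 1) * x powr (- p) / (c - 1) * F) {x..1}"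
proof
  let ?F = "integral {0..1} (\<lambda>r. (1 - (1 - 1 / x) * (1 - r powr (1 / (c - 1)))) powr (- p))"
  show "hyp2F1 1 (of_real p) (of_real c) (of_real (1 - 1 / x)) = of_real ?F"
    using c x by (intro hyp2F1_1_eq_integral) auto
  show "((\<lambda>v. v powr (- p) * (1 - v) powr (c - 2)) has_integral
          (1 - x) powr (c - 1) * x powr (- p) / (c - 1) * ?F) {x..1}"
  proof (cases "x = 1")
    case True
    then show ?thesis
      by (simp add: has_integral_refl)
  next
    case False
    have "1 - (1 - x) * w = x * (1 - (1 - 1 / x) * (1 - w))" for w
      using x by (simp add: field_simps)
    then have "(1 - (1 - x) * r powr (1 / (c - 1))) powr (- p) =
        x powr (- p) * (1 - (1 - 1 / x) * (1 - r powr (1 / (c - 1)))) powr (- p)" if "r \<in> {0..1}" for r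
      using x that c mult_left_le[of "r powr (1 / (c - 1))" "1 - x"]
      by (simp add: powr_mult)
    then have "integral {0..1} (\<lambda>r. (1 - (1 - x) * r powr (1 / (c - 1))) powr (- p)) = x powr (- p) * ?F"
      unfolding integral_mult_right[symmetric] by (intro integral_cong) 
    moreover have "continuous_on {x..1} (\<lambda>v. v powr (- p))"
      using x by (intro continuous_intros) auto
    ultimately show ?thesis
      using integral_singular_endpoint[OF c, of x "\<lambda>v. v powr (- p)"] x False
      by (simp add: mult_ac)
  qed
qed

section \<open>The covariance as a double integral\<close>

text \<open>The substitution \<open>v = u (y-z) / (z (y-u))\<close> maps \<open>[0, z]\<close> to \<open>[0, 1]\<close>, with
  \<open>1 - v = y (z-u) / (z (y-u))\<close> and \<open>dv/du = y (y-z) / (z (y-u)\<^sup>2)\<close>. The Beta integrand therefore becomes a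
  product of powers of \<open>u\<close>, \<open>z - u\<close> and \<open>y - u\<close> whose exponents add up to \<open>-2\<close>.\<close>

lemma nn_integral_Moebius_Beta:
  fixes p q y z :: real
  assumes p: "0 < p" and q: "0 < q" and z: "0 < z" "z < y"
  shows "(\<integral>\<^sup>+u\<in>{0..z}. ennreal (u powr (q - 1) * (z - u) powr (p - 1) * (y - u) powr (- p - q)) \<partial>lborel)
    = ennreal (Beta p q * (z powr (p + q - 1) * y powr (- p) * (y - z) powr (- q)))"
proof -
  let ?D = "y - z"
  let ?g = "\<lambda>u. u * ?D / (z * (y - u))"
  let ?g' = "\<lambda>u. y * ?D / (z * (y - u)\<^sup>2)"
  \<comment> \<open>the constant that remains when all powers of \<open>u\<close>, \<open>z - u\<close> and \<open>y - u\<close> are collected\<close>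
  define K where "K = z powr (p + q - 1) * y powr (- p) * ?D powr (- q)"
  have K: "0 < K"
    using z by (simp add: K_def)
  let ?B = "\<lambda>v. v powr (q - 1) * (1 - v) powr (p - 1)"
  let ?f = "\<lambda>u. u powr (q - 1) * (z - u) powr (p - 1) * (y - u) powr (- p - q)"
  have change: "?f u = K * (?B (?g u) * ?g' u)" if u: "u \<in> {0..z}" for u
  proof -
    have Y: "0 < y - u" "0 \<le> z - u" "0 \<le> u"
      using u z by auto
    have "1 - ?g u = y * (z - u) / (z * (y - u))"
      using Y z by (simp add: field_simps)
    then have B_eq: "?B (?g u) = u powr (q - 1) * ?D powr (q - 1) / (z powr (q - 1) * (y - u) powr (q - 1)) *
        (y powr (p - 1) * (z - u) powr (p - 1) / (z powr (p - 1) * (y - u) powr (p - 1)))"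
      using Y z by (simp add: powr_mult powr_divide)
    have K_eq: "K = z * z powr (p - 1) * z powr (q - 1) / (y * y powr (p - 1) * (?D * ?D powr (q - 1)))"
    proof -
      have "z powr (p + q - 1) = z * z powr (p - 1) * z powr (q - 1)"
        using z powr_add[of z "1 + (p - 1)" "q - 1"] powr_add[of z 1 "p - 1"] by (simp add: algebra_simps)
      moreover have "y powr p = y * y powr (p - 1)" "?D powr q = ?D * ?D powr (q - 1)"
        using z powr_add[of y 1 "p - 1"] powr_add[of ?D 1 "q - 1"] by auto
      ultimately show ?thesis
        by (simp add: K_def powr_minus divide_inverse)
    qed
    have Y_eq: "(y - u) powr (- p - q) = 1 / ((y - u)\<^sup>2 * (y - u) powr (p - 1) * (y - u) powr (q - 1))"
    proof -
      have "(y - u) powr (p + q) = (y - u)\<^sup>2 * (y - u) powr (p - 1) * (y - u) powr (q - 1)"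
        using Y powr_add[of "y - u" "2 + (p - 1)" "q - 1"] powr_add[of "y - u" 2 "p - 1"]
        by (simp add: algebra_simps)
      then show ?thesis
        using powr_minus[of "y - u" "p + q"] by (simp add: divide_inverse)
    qed
    have alg: "u1 * w2 * (1 / (v * y2 * y1)) =
        (z * z2 * z1 / (y * x2 * (d * d1))) * (u1 * d1 / (z1 * y1) * (x2 * w2 / (z2 * y2)) * (y * d / (z * v)))"
      if "0 < y2" "0 < y1" "0 < z" "0 < z2" "0 < z1" "0 < y" "0 < x2" "0 < d" "0 < d1" "0 < v"
      for u1 w2 v y2 y1 z z2 z1 y x2 d d1 :: real
      using that by (simp add: field_simps)
    show ?thesis
      unfolding B_eq K_eq Y_eq using Y z by (intro alg) auto
  qed
  have "(\<integral>\<^sup>+u\<in>{0..z}. ennreal (?f u) \<partial>lborel) =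
      (\<integral>\<^sup>+u. ennreal K * ennreal (?B (?g u) * ?g' u * indicator {0..z} u) \<partial>lborel)"
  proof (rule nn_integral_cong)
    show "ennreal (?f u) * indicator {0..z} u =
        ennreal K * ennreal (?B (?g u) * ?g' u * indicator {0..z} u)" for u
    proof (cases "u \<in> {0..z}")
      case True
      show ?thesis
        unfolding change[OF True] using True K by (simp only: ennreal_mult' less_imp_le) simp
    qed simp
  qed
  also have "\<dots> = ennreal K * (\<integral>\<^sup>+u. ennreal (?B (?g u) * ?g' u * indicator {0..z} u) \<partial>lborel)"
    by (intro nn_integral_cmult) measurable
  also have "(\<integral>\<^sup>+u. ennreal (?B (?g u) * ?g' u * indicator {0..z} u) \<partial>lborel) =
      (\<integral>\<^sup>+v. ennreal (?B v * indicator {?g 0..?g z} v) \<partial>lborel)"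
  proof (rule nn_integral_substitution[symmetric])
    show "set_borel_measurable borel {?g 0..?g z} ?B"
      unfolding set_borel_measurable_def by measurable
    show "(?g has_real_derivative ?g' u) (at u)" if "u \<in> {0..z}" for u
    proof (rule DERIV_cong)
      show "(?g has_real_derivative (?D * (z * (y - u)) - u * ?D * (- z)) / (z * (y - u))\<^sup>2) (at u)"
        using that z by (auto intro!: derivative_eq_intros simp: power2_eq_square)
      have "?D * (z * (y - u)) - u * ?D * (- z) = z * (y * ?D)"
        by (simp add: algebra_simps)
      moreover have "(z * (y - u))\<^sup>2 = z * (z * (y - u)\<^sup>2)"
        by (simp add: power2_eq_square)
      ultimately show "(?D * (z * (y - u)) - u * ?D * (- z)) / (z * (y - u))\<^sup>2 = ?g' u"
        using z by simp
    qed
    show "continuous_on {0..z} ?g'"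
      using z by (intro continuous_intros) auto
  qed (use z in auto)
  also have "\<dots> = (\<integral>\<^sup>+v\<in>{0..1}. ennreal (?B v) \<partial>lborel)"
    using z by (intro nn_integral_cong) (auto split: split_indicator)
  also have "\<dots> = ennreal (Beta p q)"
    using nn_integral_Beta[OF q p] by (simp add: Beta_commute)
  also have "ennreal K * ennreal (Beta p q) = ennreal (Beta p q * K)"
    using K by (subst mult.commute) (simp add: ennreal_mult'')
  finally show ?thesis
    unfolding K_def .
qed

text \<open>For \<open>0 \<le> u\<close> the factor \<open>y^(a-1/2)\<close> is bounded on \<open>[u, t]\<close>, and \<open>(y-u)^(a-3/2)\<close> is integrable because its
  exponent exceeds \<open>-1\<close>.\<close>

lemma nn_integral_kernel_finite:
  assumes "1 / 2 < a" "0 \<le> u"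
  shows "(\<integral>\<^sup>+y\<in>{u..t}. ennreal ((y - u) powr (a - 3 / 2) * y powr (a - 1 / 2)) \<partial>lborel) < \<infinity>"
proof (cases "u \<le> t")
  case True
  have "(\<integral>\<^sup>+y\<in>{u..t}. ennreal ((y - u) powr (a - 3 / 2) * y powr (a - 1 / 2)) \<partial>lborel)
      \<le> (\<integral>\<^sup>+y. ennreal (t powr (a - 1 / 2)) * (ennreal ((y - u) powr (a - 1 / 2 - 1)) * indicator {u..t} y) \<partial>lborel)"
    using assms
    by (intro nn_integral_mono)
       (auto split: split_indicator simp: mult.commute[of "_ powr (a - 3 / 2)"]
         intro!: mult_right_mono powr_mono2 ennreal_leI simp flip: ennreal_mult')
  also have "\<dots> = ennreal (t powr (a - 1 / 2)) * ennreal (((t - u) powr (a - 1 / 2) - (u - u) powr (a - 1 / 2)) / (a - 1 / 2))"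
    using assms True
    by (subst nn_integral_cmult, measurable) (subst nn_integral_powr_shifted; simp)
  also have "\<dots> < \<infinity>"
    by (simp add: ennreal_mult_less_top)
  finally show ?thesis .
qed simp

text \<open>The density of the covariance, up to the factor \<open>c_prod\<close>, on the rectangle \<open>[0, t] \<times> [0, s]\<close>, for
  \<open>a = H t\<close> and \<open>b = H s\<close>. The two Beta values are \<open>beta1 H s t\<close> and \<open>beta1 H t s\<close>.\<close>

definition cov_density :: "real \<Rightarrow> real \<Rightarrow> real \<Rightarrow> real \<Rightarrow> real" where
  "cov_density a b y z =
     (Beta (b - 1 / 2) (2 - a - b) * of_bool (y > z) + Beta (a - 1 / 2) (2 - a - b) * of_bool (y < z)) *
     (y / z) powr (a - b) * \<bar>y - z\<bar> powr (a + b - 2)"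

lemma cov_density_measurable [measurable (raw)]:
  assumes [measurable]: "f \<in> borel_measurable M" "g \<in> borel_measurable M"
  shows "(\<lambda>x. cov_density a b (f x) (g x)) \<in> borel_measurable M"
  unfolding cov_density_def of_bool_def by measurable

text \<open>The case \<open>p = b - 1/2\<close>, \<open>q = 2 - a - b\<close> of \<open>nn_integral_Moebius_Beta\<close>, in which \<open>- p - q = a - 3/2\<close>.\<close>

lemma nn_integral_kernel_product_below:
  assumes b: "1 / 2 < b" and ab: "a + b < 2" and z: "0 < z" "z < y"
  shows "(\<integral>\<^sup>+u\<in>{0..z}. ennreal (u powr (1 - a - b) *
      (((y - u) powr (a - 3 / 2) * y powr (a - 1 / 2)) * ((z - u) powr (b - 3 / 2) * z powr (b - 1 / 2)))) \<partial>lborel)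
    = ennreal (Beta (b - 1 / 2) (2 - a - b) * ((y / z) powr (a - b) * (y - z) powr (a + b - 2)))"
    (is "?L = _")
proof -
  let ?c = "y powr (a - 1 / 2) * z powr (b - 1 / 2)"
  let ?p = "b - 1 / 2" and ?q = "2 - a - b"
  have "(\<integral>\<^sup>+u\<in>{0..z}. ennreal (u powr (?q - 1) * (z - u) powr (?p - 1) * (y - u) powr (- ?p - ?q)) \<partial>lborel)
      = ennreal (Beta ?p ?q * (z powr (?p + ?q - 1) * y powr (- ?p) * (y - z) powr (- ?q)))"
    using b ab z by (intro nn_integral_Moebius_Beta) auto
  moreover have "?q - 1 = 1 - a - b" "?p - 1 = b - 3 / 2" "- ?p - ?q = a - 3 / 2" "?p + ?q - 1 = 1 / 2 - a"
      "- ?p = 1 / 2 - b" "- ?q = a + b - 2"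
    by simp_all
  ultimately have Moebius: "(\<integral>\<^sup>+u\<in>{0..z}. ennreal (u powr (1 - a - b) * (z - u) powr (b - 3 / 2) * (y - u) powr (a - 3 / 2)) \<partial>lborel)
      = ennreal (Beta ?p ?q * (z powr (1 / 2 - a) * y powr (1 / 2 - b) * (y - z) powr (a + b - 2)))"
    by metis
  have "?L = (\<integral>\<^sup>+u. ennreal ?c *
      (ennreal (u powr (1 - a - b) * (z - u) powr (b - 3 / 2) * (y - u) powr (a - 3 / 2)) * indicator {0..z} u) \<partial>lborel)"
    by (intro nn_integral_cong)
       (auto split: split_indicator simp: mult_ac simp flip: ennreal_mult')
  also have "\<dots> = ennreal ?c * ennreal (Beta ?p ?q * (z powr (1 / 2 - a) * y powr (1 / 2 - b) * (y - z) powr (a + b - 2)))"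
    by (subst nn_integral_cmult, measurable) (simp only: Moebius)
  also have "\<dots> = ennreal (Beta ?p ?q * ((?c * z powr (1 / 2 - a) * y powr (1 / 2 - b)) * (y - z) powr (a + b - 2)))"
    by (simp add: mult_ac flip: ennreal_mult')
  also have "?c * z powr (1 / 2 - a) * y powr (1 / 2 - b) = (y / z) powr (a - b)"
  proof -
    have "y powr (a - 1 / 2) * y powr (1 / 2 - b) = y powr (a - b)"
      by (simp flip: powr_add)
    moreover have "z powr (b - 1 / 2) * z powr (1 / 2 - a) = z powr (- (a - b))"
      by (simp flip: powr_add)
    moreover have "(y / z) powr (a - b) = y powr (a - b) * z powr (- (a - b))"
      using z by (subst powr_minus) (simp add: powr_divide flip: divide_inverse)
    moreover have "?c * z powr (1 / 2 - a) * y powr (1 / 2 - b) =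
        (y powr (a - 1 / 2) * y powr (1 / 2 - b)) * (z powr (b - 1 / 2) * z powr (1 / 2 - a))"
      by (simp only: mult_ac)
    ultimately show ?thesis
      by (simp only:)
  qed
  finally show ?thesis .
qed

text \<open>By \<open>x / 0 = 0\<close> and \<open>0 powr d = 0\<close> this includes the case that \<open>y\<close> or \<open>z\<close> vanishes.\<close>

lemma powr_ratio_swap:
  fixes y z d :: real
  assumes "0 \<le> y" "0 \<le> z"
  shows "(y / z) powr d = (z / y) powr (- d)"
  using assms by (simp add: powr_minus flip: inverse_powr)

lemma nn_integral_kernel_product:
  assumes a: "1 / 2 < a" and b: "1 / 2 < b" and ab: "a + b < 2" and yz: "0 < y" "0 < z" "y \<noteq> z"
  shows "(\<integral>\<^sup>+u\<in>{0..min y z}. ennreal (u powr (1 - a - b) *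
      (((y - u) powr (a - 3 / 2) * y powr (a - 1 / 2)) * ((z - u) powr (b - 3 / 2) * z powr (b - 1 / 2)))) \<partial>lborel)
    = ennreal (cov_density a b y z)"
proof (cases "z < y")
  case True
  then show ?thesis
    using nn_integral_kernel_product_below[OF b ab \<open>0 < z\<close> True]
    by (simp add: cov_density_def mult.assoc)
next
  case False
  then have yz': "y < z"
    using yz by simp
  have ba: "b + a < 2" "1 - b - a = 1 - a - b" "2 - b - a = 2 - a - b" "b + a - 2 = a + b - 2"
    using ab by auto
  show ?thesis
    using nn_integral_kernel_product_below[OF a ba(1) \<open>0 < y\<close> yz'] yz' yz powr_ratio_swap[of y z "a - b"]
    unfolding ba by (simp add: cov_density_def mult_ac)
qed

text \<open>Tonelli's theorem for the three variables \<open>u \<le> min y z\<close>, \<open>y \<le> t\<close>, \<open>z \<le> s\<close>: integrating over \<open>u\<close> last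
  gives the covariance, integrating over \<open>u\<close> first gives the density.\<close>

lemma nn_integral_covariance:
  assumes a: "1 / 2 < a" and b: "1 / 2 < b" and ab: "a + b < 2"
  defines "k \<equiv> \<lambda>h u y. (y - u) powr (h - 3 / 2) * y powr (h - 1 / 2)"
  shows "(\<integral>\<^sup>+u\<in>{0..min s t}. (ennreal (u powr (1 - a - b)) *
        ((\<integral>\<^sup>+y\<in>{u..t}. ennreal (k a u y) \<partial>lborel) * (\<integral>\<^sup>+z\<in>{u..s}. ennreal (k b u z) \<partial>lborel))) \<partial>lborel)
    = (\<integral>\<^sup>+y\<in>{0..t}. (\<integral>\<^sup>+z\<in>{0..s}. ennreal (cov_density a b y z) \<partial>lborel) \<partial>lborel)"
    (is "?L = ?R")
proof -
  define G where "G = (\<lambda>u y z. ennreal (u powr (1 - a - b) * (k a u y * k b u z)) *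
    of_bool (0 \<le> u \<and> u \<le> y \<and> u \<le> z \<and> y \<le> t \<and> z \<le> s))"
  have k_nonneg: "0 \<le> k h u y" for h u y
    by (simp add: k_def)
  have G_measurable [measurable (raw)]: "(\<lambda>x. G (f x) (g x) (h x)) \<in> borel_measurable M"
    if [measurable]: "f \<in> borel_measurable M" "g \<in> borel_measurable M" "h \<in> borel_measurable M"
    for f g h and M :: "'m measure"
    unfolding G_def k_def of_bool_def by measurable
  have "?L = (\<integral>\<^sup>+u. \<integral>\<^sup>+y. \<integral>\<^sup>+z. G u y z \<partial>lborel \<partial>lborel \<partial>lborel)"
  proof (rule nn_integral_cong)
    fix u :: real
    have [measurable]: "k h u \<in> borel_measurable borel" for h
      unfolding k_def by measurable
    have "(\<integral>\<^sup>+y. \<integral>\<^sup>+z. G u y z \<partial>lborel \<partial>lborel) =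
      (\<integral>\<^sup>+y. \<integral>\<^sup>+z. (ennreal (u powr (1 - a - b)) * indicator {0..} u * (ennreal (k a u y) * indicator {u..t} y)) *
          (ennreal (k b u z) * indicator {u..s} z) \<partial>lborel \<partial>lborel)"
      by (intro nn_integral_cong)
         (auto simp: G_def k_nonneg ennreal_mult' mult_ac split: split_indicator)
    also have "\<dots> = (\<integral>\<^sup>+y. ennreal (u powr (1 - a - b)) * indicator {0..} u * (ennreal (k a u y) * indicator {u..t} y) *
          (\<integral>\<^sup>+z\<in>{u..s}. ennreal (k b u z) \<partial>lborel) \<partial>lborel)"
      by (intro nn_integral_cong nn_integral_cmult) measurable
    also have "\<dots> = (\<integral>\<^sup>+y. ennreal (u powr (1 - a - b)) * indicator {0..} u * (ennreal (k a u y) * indicator {u..t} y) \<partial>lborel) *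
          (\<integral>\<^sup>+z\<in>{u..s}. ennreal (k b u z) \<partial>lborel)"
      by (rule nn_integral_multc) measurable
    also have "\<dots> = ennreal (u powr (1 - a - b)) * indicator {0..} u *
        ((\<integral>\<^sup>+y\<in>{u..t}. ennreal (k a u y) \<partial>lborel) * (\<integral>\<^sup>+z\<in>{u..s}. ennreal (k b u z) \<partial>lborel))"
      by (subst nn_integral_cmult) (measurable, simp add: mult.assoc)
    also have "\<dots> = ennreal (u powr (1 - a - b)) *
        ((\<integral>\<^sup>+y\<in>{u..t}. ennreal (k a u y) \<partial>lborel) * (\<integral>\<^sup>+z\<in>{u..s}. ennreal (k b u z) \<partial>lborel)) *
        indicator {0..min s t} u"
      by (cases "u \<le> t"; cases "u \<le> s") (auto split: split_indicator)
    finally show "ennreal (u powr (1 - a - b)) *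
        ((\<integral>\<^sup>+y\<in>{u..t}. ennreal (k a u y) \<partial>lborel) * (\<integral>\<^sup>+z\<in>{u..s}. ennreal (k b u z) \<partial>lborel)) *
        indicator {0..min s t} u = (\<integral>\<^sup>+y. \<integral>\<^sup>+z. G u y z \<partial>lborel \<partial>lborel)"
      by simp
  qed
  also have "\<dots> = (\<integral>\<^sup>+y. \<integral>\<^sup>+u. \<integral>\<^sup>+z. G u y z \<partial>lborel \<partial>lborel \<partial>lborel)"
    by (rule lborel_pair.Fubini'[symmetric]) measurable
  also have "\<dots> = (\<integral>\<^sup>+y. \<integral>\<^sup>+z. \<integral>\<^sup>+u. G u y z \<partial>lborel \<partial>lborel \<partial>lborel)"
    by (intro nn_integral_cong lborel_pair.Fubini'[symmetric]) measurable
  also have "\<dots> = ?R"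
  proof (rule nn_integral_cong_AE)
    have "AE y in lborel. y \<noteq> (0 :: real)"
      by (rule AE_lborel_singleton)
    then show "AE y in lborel. (\<integral>\<^sup>+z. \<integral>\<^sup>+u. G u y z \<partial>lborel \<partial>lborel) =
        (\<integral>\<^sup>+z\<in>{0..s}. ennreal (cov_density a b y z) \<partial>lborel) * indicator {0..t} y"
    proof eventually_elim
      fix y :: real assume y: "y \<noteq> 0"
      have "AE z in lborel. (\<integral>\<^sup>+u. G u y z \<partial>lborel) =
          ennreal (cov_density a b y z) * indicator {0..s} z * indicator {0..t} y"
        using AE_lborel_singleton[of 0] AE_lborel_singleton[of y]
      proof eventually_elim
        fix z :: real assume z: "z \<noteq> 0" "z \<noteq> y"
        show "(\<integral>\<^sup>+u. G u y z \<partial>lborel) =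
          ennreal (cov_density a b y z) * indicator {0..s} z * indicator {0..t} y"
        proof (cases "0 < y \<and> y \<le> t \<and> 0 < z \<and> z \<le> s")
          case True
          then have "(\<integral>\<^sup>+u. G u y z \<partial>lborel) =
              (\<integral>\<^sup>+u\<in>{0..min y z}. ennreal (u powr (1 - a - b) * (k a u y * k b u z)) \<partial>lborel)"
            by (intro nn_integral_cong) (auto simp: G_def split: split_indicator)
          also have "\<dots> = ennreal (cov_density a b y z)"
            unfolding k_def using True z by (intro nn_integral_kernel_product a b ab) auto
          finally show ?thesis
            using True by simp
        next
          case False
          then have "G u y z = 0" for u
            using y z by (auto simp: G_def)
          moreover have "indicator {0..s} z * indicator {0..t} y = (0 :: ennreal)"
            using False y z by (auto split: split_indicator)
          ultimately show ?thesis
            by (simp add: mult.assoc)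
        qed
      qed
      then have "(\<integral>\<^sup>+z. \<integral>\<^sup>+u. G u y z \<partial>lborel \<partial>lborel) =
          (\<integral>\<^sup>+z. ennreal (cov_density a b y z) * indicator {0..s} z * indicator {0..t} y \<partial>lborel)"
        by (rule nn_integral_cong_AE)
      also have "\<dots> = (\<integral>\<^sup>+z\<in>{0..s}. ennreal (cov_density a b y z) \<partial>lborel) * indicator {0..t} y"
        by (rule nn_integral_multc) measurable
      finally show "(\<integral>\<^sup>+z. \<integral>\<^sup>+u. G u y z \<partial>lborel \<partial>lborel) =
        (\<integral>\<^sup>+z\<in>{0..s}. ennreal (cov_density a b y z) \<partial>lborel) * indicator {0..t} y" .
    qed
  qed
  finally show ?thesis .
qed

text \<open>The inner integrals of the Volterra kernels are finite, so the product of the kernels is the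
  integrand in \<open>nn_integral_covariance\<close>.\<close>

lemma R_H_eq_nn_integral:
  assumes a: "1 / 2 < H t" "H t < 1" and b: "1 / 2 < H s" "H s < 1"
  shows "R_H H t s = c_prod H t s *
    enn2real (\<integral>\<^sup>+y\<in>{0..t}. (\<integral>\<^sup>+z\<in>{0..s}. ennreal (cov_density (H t) (H s) y z) \<partial>lborel) \<partial>lborel)"
proof -
  define k where "k = (\<lambda>h u y::real. (y - u) powr (h - 3 / 2) * y powr (h - 1 / 2))"
  have k_measurable [measurable (raw)]: "(\<lambda>x. k h (f x) (g x)) \<in> borel_measurable M"
    if [measurable]: "f \<in> borel_measurable M" "g \<in> borel_measurable M" for f g h and M :: "'m measure"
    unfolding k_def by measurable
  define I where "I = (\<lambda>h x u. \<integral>\<^sup>+y\<in>{u..x}. ennreal (k h u y) \<partial>lborel)"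
  have [measurable]: "I h x \<in> borel_measurable borel" for h x
    unfolding I_def by measurable
  have LBINT_k: "(LBINT y:{u..x}. k h u y) = enn2real (I h x u)" for h u x
    unfolding I_def by (rule LBINT_eq_enn2real) (measurable, simp add: k_def)
  have finite: "I h x u < \<infinity>" if "1 / 2 < h" "0 \<le> u" for h u x
    unfolding I_def k_def using that by (rule nn_integral_kernel_finite)
  have "R_H H t s = (LBINT u:{0..min s t}. c_prod H t s *
      (u powr (1 - H t - H s) * (enn2real (I (H t) t u) * enn2real (I (H s) s u))))"
    unfolding R_H_def
  proof (rule set_lebesgue_integral_cong)
    show "\<forall>u. u \<in> {0..min s t} \<longrightarrow> K_H H t u * K_H H s u =
        c_prod H t s * (u powr (1 - H t - H s) * (enn2real (I (H t) t u) * enn2real (I (H s) s u)))"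
    proof (intro allI impI)
      fix u assume u: "u \<in> {0..min s t}"
      have "u powr (1 / 2 - H t) * u powr (1 / 2 - H s) = u powr (1 - H t - H s)"
        by (simp only: powr_add[symmetric]) (simp add: algebra_simps)
      then show "K_H H t u * K_H H s u =
          c_prod H t s * (u powr (1 - H t - H s) * (enn2real (I (H t) t u) * enn2real (I (H s) s u)))"
        using u unfolding K_H_def c_prod_def k_def[symmetric] LBINT_k[unfolded k_def] by simp
    qed
  qed simp
  also have "\<dots> = c_prod H t s * (LBINT u:{0..min s t}. u powr (1 - H t - H s) *
      (enn2real (I (H t) t u) * enn2real (I (H s) s u)))"
    by (rule set_integral_mult_right)
  also have "(LBINT u:{0..min s t}. u powr (1 - H t - H s) * (enn2real (I (H t) t u) * enn2real (I (H s) s u))) =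
      enn2real (\<integral>\<^sup>+u\<in>{0..min s t}. ennreal (u powr (1 - H t - H s) *
        (enn2real (I (H t) t u) * enn2real (I (H s) s u))) \<partial>lborel)"
    by (rule LBINT_eq_enn2real) auto
  also have "(\<integral>\<^sup>+u\<in>{0..min s t}. ennreal (u powr (1 - H t - H s) *
        (enn2real (I (H t) t u) * enn2real (I (H s) s u))) \<partial>lborel) =
      (\<integral>\<^sup>+u\<in>{0..min s t}. (ennreal (u powr (1 - H t - H s)) * (I (H t) t u * I (H s) s u)) \<partial>lborel)"
    using finite a b
    by (intro nn_integral_cong) (auto split: split_indicator simp: ennreal_mult' ennreal_enn2real)
  also have "\<dots> = (\<integral>\<^sup>+y\<in>{0..t}. (\<integral>\<^sup>+z\<in>{0..s}. ennreal (cov_density (H t) (H s) y z) \<partial>lborel) \<partial>lborel)"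
    unfolding I_def k_def using a b by (intro nn_integral_covariance) auto
  finally show ?thesis .
qed

lemma R_H_commute: "R_H H t s = R_H H s t"
  by (simp add: R_H_def min.commute mult.commute)

section \<open>Integrals of the power kernel\<close>

text \<open>The density of the covariance on one side of the diagonal, up to a constant, with \<open>d = H t - H s\<close> and
  \<open>c = H t + H s\<close>. Homogeneity of degree \<open>c - 2\<close> drives all computations below.\<close>

definition power_kernel :: "real \<Rightarrow> real \<Rightarrow> real \<Rightarrow> real \<Rightarrow> real" where
  "power_kernel d c y z = (y / z) powr d * \<bar>y - z\<bar> powr (c - 2)"

lemma power_kernel_measurable [measurable (raw)]:
  assumes [measurable]: "f \<in> borel_measurable M" "g \<in> borel_measurable M"
  shows "(\<lambda>x. power_kernel d c (f x) (g x)) \<in> borel_measurable M"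
  unfolding power_kernel_def by measurable

lemma power_kernel_swap: "0 \<le> y \<Longrightarrow> 0 \<le> z \<Longrightarrow> power_kernel d c y z = power_kernel (- d) c z y"
  using powr_ratio_swap[of y z d] by (simp add: power_kernel_def abs_minus_commute)

text \<open>Homogeneity, as the substitution \<open>z = y v\<close>.\<close>

lemma nn_integral_power_kernel_scale:
  assumes "0 < y" "0 \<le> s" "s \<le> y"
  shows "(\<integral>\<^sup>+z\<in>{0..s}. ennreal (power_kernel d c y z) \<partial>lborel) =
    ennreal (y powr (c - 1)) * (\<integral>\<^sup>+v\<in>{0..s / y}. ennreal (v powr (- d) * (1 - v) powr (c - 2)) \<partial>lborel)"
proof -
  have "(\<integral>\<^sup>+z\<in>{0..s}. ennreal (power_kernel d c y z) \<partial>lborel) =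
      ennreal \<bar>y\<bar> * (\<integral>\<^sup>+v. ennreal (power_kernel d c y (0 + y * v)) * indicator {0..s} (0 + y * v) \<partial>lborel)"
    using assms by (intro nn_integral_real_affine) auto
  also have "(\<integral>\<^sup>+v. ennreal (power_kernel d c y (0 + y * v)) * indicator {0..s} (0 + y * v) \<partial>lborel) =
      (\<integral>\<^sup>+v. ennreal (y powr (c - 2)) * (ennreal (v powr (- d) * (1 - v) powr (c - 2)) * indicator {0..s / y} v) \<partial>lborel)"
  proof (rule nn_integral_cong)
    fix v :: real
    have iff: "0 + y * v \<in> {0..s} \<longleftrightarrow> v \<in> {0..s / y}"
      using assms by (auto simp: field_simps zero_le_mult_iff)
    show "ennreal (power_kernel d c y (0 + y * v)) * indicator {0..s} (0 + y * v) =
      ennreal (y powr (c - 2)) * (ennreal (v powr (- d) * (1 - v) powr (c - 2)) * indicator {0..s / y} v)"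
    proof (cases "v \<in> {0..s / y}")
      case True
      then have v: "0 \<le> v" "v \<le> s / y" "v \<le> 1"
        using assms by (auto intro: order.trans[of v "s / y" 1])
      have "(y / (y * v)) powr d = v powr (- d)"
        using assms v powr_ratio_swap[of 1 v d] by simp
      moreover have "\<bar>y - y * v\<bar> = y * (1 - v)"
        using assms v by (simp add: algebra_simps mult_left_le)
      ultimately have "power_kernel d c y (0 + y * v) = y powr (c - 2) * (v powr (- d) * (1 - v) powr (c - 2))"
        using assms v by (simp add: power_kernel_def powr_mult)
      then show ?thesis
        using True iff by (simp only: ennreal_mult' powr_ge_zero indicator_simps mult_1_right)
    next
      case False
      then show ?thesis
        using iff by simp
    qed
  qed
  also have "\<dots> = ennreal (y powr (c - 2)) * (\<integral>\<^sup>+v\<in>{0..s / y}. ennreal (v powr (- d) * (1 - v) powr (c - 2)) \<partial>lborel)"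
    by (rule nn_integral_cmult) measurable
  also have "ennreal \<bar>y\<bar> * (ennreal (y powr (c - 2)) * I) = ennreal (y powr (c - 1)) * I" for I
  proof -
    have "\<bar>y\<bar> * y powr (c - 2) = y powr (c - 1)"
      using assms powr_add[of y 1 "c - 2"] by simp
    then show ?thesis
      by (simp only: mult.assoc[symmetric] ennreal_mult'[symmetric] abs_ge_zero)
  qed
  finally show ?thesis .
qed

lemma nn_integral_power_kernel_below:
  assumes d: "d < 1" and c: "1 < c" and y: "0 \<le> y"
  shows "(\<integral>\<^sup>+z\<in>{0..y}. ennreal (power_kernel d c y z) \<partial>lborel) = ennreal (Beta (1 - d) (c - 1) * y powr (c - 1))"
proof (cases "y = 0")
  case True
  then have "(\<integral>\<^sup>+z\<in>{0..y}. ennreal (power_kernel d c y z) \<partial>lborel) = (\<integral>\<^sup>+z. 0 \<partial>(lborel :: real measure))"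
    by (intro nn_integral_cong) (auto split: split_indicator simp: power_kernel_def)
  then show ?thesis
    using True by simp
next
  case False
  moreover have "(\<integral>\<^sup>+v\<in>{0..1}. ennreal (v powr (- d) * (1 - v) powr (c - 2)) \<partial>lborel) = ennreal (Beta (1 - d) (c - 1))"
    using nn_integral_Beta[of "1 - d" "c - 1"] d c by simp
  ultimately show ?thesis
    using nn_integral_power_kernel_scale[of y y d c] y
    by (simp only: order.refl divide_self mult.commute[of "ennreal (y powr (c - 1))"]) (simp add: ennreal_mult'')
qed

lemma nn_integral_power_kernel_trapezoid:
  assumes d: "d < 1" and c: "1 < c" and st: "0 \<le> s" "s \<le> t"
  shows "(\<integral>\<^sup>+y\<in>{s..t}. (\<integral>\<^sup>+z\<in>{0..y}. ennreal (power_kernel d c y z) \<partial>lborel) \<partial>lborel)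
    = ennreal (Beta (1 - d) (c - 1) * ((t powr c - s powr c) / c))"
proof -
  have B: "0 \<le> Beta (1 - d) (c - 1)"
    using d c Beta_pos[of "1 - d" "c - 1"] by simp
  have "(\<integral>\<^sup>+y\<in>{s..t}. (\<integral>\<^sup>+z\<in>{0..y}. ennreal (power_kernel d c y z) \<partial>lborel) \<partial>lborel)
      = (\<integral>\<^sup>+y. ennreal (Beta (1 - d) (c - 1)) * (ennreal ((y - 0) powr (c - 1)) * indicator {s..t} y) \<partial>lborel)"
    using st B
    by (intro nn_integral_cong)
       (auto split: split_indicator simp: nn_integral_power_kernel_below[OF d c] ennreal_mult')
  also have "\<dots> = ennreal (Beta (1 - d) (c - 1)) * ennreal (((t - 0) powr c - (s - 0) powr c) / c)"
    using c st by (subst nn_integral_cmult, measurable) (subst nn_integral_powr_shifted; simp)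
  also have "\<dots> = ennreal (Beta (1 - d) (c - 1) * ((t powr c - s powr c) / c))"
    unfolding diff_0_right by (rule ennreal_mult'[OF B, symmetric])
  finally show ?thesis .
qed

text \<open>The trapezoid \<open>s \<le> y \<le> t, 0 \<le> z \<le> y\<close> is the rectangle \<open>[s, t] \<times> [0, s]\<close> together with the triangle
  \<open>s \<le> z \<le> y \<le> t\<close>, which the last summand sweeps in the other order.\<close>

lemma nn_integral_power_kernel_split:
  assumes st: "0 \<le> s" "s \<le> t"
  shows "(\<integral>\<^sup>+y\<in>{s..t}. (\<integral>\<^sup>+z\<in>{0..y}. ennreal (power_kernel d c y z) \<partial>lborel) \<partial>lborel)
    = (\<integral>\<^sup>+y\<in>{s..t}. (\<integral>\<^sup>+z\<in>{0..s}. ennreal (power_kernel d c y z) \<partial>lborel) \<partial>lborel) +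
      (\<integral>\<^sup>+z\<in>{s..t}. (\<integral>\<^sup>+y\<in>{z..t}. ennreal (power_kernel d c y z) \<partial>lborel) \<partial>lborel)"
proof -
  let ?k = "\<lambda>y z. ennreal (power_kernel d c y z)"
  have "(\<integral>\<^sup>+y\<in>{s..t}. (\<integral>\<^sup>+z\<in>{0..y}. ?k y z \<partial>lborel) \<partial>lborel) =
      (\<integral>\<^sup>+y. (\<integral>\<^sup>+z\<in>{0..s}. ?k y z \<partial>lborel) * indicator {s..t} y + (\<integral>\<^sup>+z\<in>{s..y}. ?k y z \<partial>lborel) * indicator {s..t} y \<partial>lborel)"
    using st by (intro nn_integral_cong) (auto split: split_indicator intro!: nn_integral_split_interval)
  also have "\<dots> = (\<integral>\<^sup>+y\<in>{s..t}. (\<integral>\<^sup>+z\<in>{0..s}. ?k y z \<partial>lborel) \<partial>lborel) +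
      (\<integral>\<^sup>+y\<in>{s..t}. (\<integral>\<^sup>+z\<in>{s..y}. ?k y z \<partial>lborel) \<partial>lborel)"
    by (rule nn_integral_add) measurable
  also have "(\<integral>\<^sup>+y\<in>{s..t}. (\<integral>\<^sup>+z\<in>{s..y}. ?k y z \<partial>lborel) \<partial>lborel) =
      (\<integral>\<^sup>+z\<in>{s..t}. (\<integral>\<^sup>+y\<in>{z..t}. ?k y z \<partial>lborel) \<partial>lborel)"
    by (rule nn_integral_triangle_swap) measurable
  finally show ?thesis .
qed

text \<open>After the substitution \<open>z = y v\<close> the region is \<open>s \<le> y \<le> t, y v \<le> s\<close>. For fixed \<open>v\<close> the variable \<open>y\<close> runs
  from \<open>s\<close> to \<open>m = min t (s/v)\<close>, which contributes \<open>(m^c - s^c) / c\<close>. Adding the Beta integral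
  removes the subtracted \<open>s^c / c\<close>, and the minimum changes its form at \<open>v = s / t\<close>.\<close>

lemma nn_integral_power_kernel_rectangle:
  assumes d: "d < 1" and c: "1 < c" and st: "0 < s" "s \<le> t"
  shows "(\<integral>\<^sup>+y\<in>{s..t}. (\<integral>\<^sup>+z\<in>{0..s}. ennreal (power_kernel d c y z) \<partial>lborel) \<partial>lborel) +
      ennreal (Beta (1 - d) (c - 1) * (s powr c / c)) =
    ennreal (s powr c / c) * (\<integral>\<^sup>+v\<in>{s / t..1}. ennreal (v powr (- d - c) * (1 - v) powr (c - 2)) \<partial>lborel) +
    ennreal (t powr c / c) * (\<integral>\<^sup>+v\<in>{0..s / t}. ennreal (v powr (- d) * (1 - v) powr (c - 2)) \<partial>lborel)"
proof -
  define w where "w = (\<lambda>v::real. v powr (- d) * (1 - v) powr (c - 2))"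
  have w_nonneg: "0 \<le> w v" for v
    by (simp add: w_def)
  have w_measurable [measurable]: "w \<in> borel_measurable borel"
    unfolding w_def by measurable
  define m where "m = (\<lambda>v. min t (s / v))"
  have m_measurable [measurable]: "m \<in> borel_measurable borel"
    unfolding m_def by measurable
  define G where "G = (\<lambda>y v. ennreal (y powr (c - 1)) * ennreal (w v) * of_bool (s \<le> y \<and> y \<le> t \<and> 0 \<le> v \<and> v \<le> s / y))"
  have G_measurable: "(\<lambda>(y, v). G y v) \<in> borel_measurable (lborel \<Otimes>\<^sub>M lborel)"
    unfolding G_def of_bool_def by measurable
  have "(\<integral>\<^sup>+y\<in>{s..t}. (\<integral>\<^sup>+z\<in>{0..s}. ennreal (power_kernel d c y z) \<partial>lborel) \<partial>lborel) =
      (\<integral>\<^sup>+y. \<integral>\<^sup>+v. G y v \<partial>lborel \<partial>lborel)"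
  proof (rule nn_integral_cong)
    show "(\<integral>\<^sup>+z\<in>{0..s}. ennreal (power_kernel d c y z) \<partial>lborel) * indicator {s..t} y = (\<integral>\<^sup>+v. G y v \<partial>lborel)" for y
    proof (cases "y \<in> {s..t}")
      case True
      then have "(\<integral>\<^sup>+z\<in>{0..s}. ennreal (power_kernel d c y z) \<partial>lborel) =
          ennreal (y powr (c - 1)) * (\<integral>\<^sup>+v\<in>{0..s / y}. ennreal (w v) \<partial>lborel)"
        unfolding w_def using st by (intro nn_integral_power_kernel_scale) auto
      also have "\<dots> = (\<integral>\<^sup>+v. ennreal (y powr (c - 1)) * (ennreal (w v) * indicator {0..s / y} v) \<partial>lborel)"
        by (rule nn_integral_cmult[symmetric]) measurable
      also have "\<dots> = (\<integral>\<^sup>+v. G y v \<partial>lborel)"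
        using True by (intro nn_integral_cong) (auto simp: G_def split: split_indicator)
      finally show ?thesis
        using True by simp
    next
      case False
      then have "G y v = 0" for v
        by (auto simp: G_def)
      then show ?thesis
        using False by simp
    qed
  qed
  also have "\<dots> = (\<integral>\<^sup>+v. \<integral>\<^sup>+y. G y v \<partial>lborel \<partial>lborel)"
    by (rule lborel_pair.Fubini'[OF G_measurable, symmetric])
  also have "\<dots> = (\<integral>\<^sup>+v\<in>{0..1}. (ennreal (w v) * ennreal ((m v powr c - s powr c) / c)) \<partial>lborel)"
  proof (rule nn_integral_cong_AE)
    have "AE v in lborel. v \<noteq> (0 :: real)"
      by (rule AE_lborel_singleton)
    then show "AE v in lborel. (\<integral>\<^sup>+y. G y v \<partial>lborel) =
        ennreal (w v) * ennreal ((m v powr c - s powr c) / c) * indicator {0..1} v"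
    proof eventually_elim
      fix v :: real assume v0: "v \<noteq> 0"
      show "(\<integral>\<^sup>+y. G y v \<partial>lborel) =
        ennreal (w v) * ennreal ((m v powr c - s powr c) / c) * indicator {0..1} v"
      proof (cases "v \<in> {0..1}")
        case True
        then have v: "0 < v" "v \<le> 1"
          using v0 by auto
        have m: "s \<le> m v"
          using v st mult_left_le[of v s] by (auto simp: m_def field_simps)
        have iff: "v \<le> s / y \<longleftrightarrow> y \<le> s / v" if "s \<le> y" for y
          using that st v by (simp add: field_simps)
        have "(\<integral>\<^sup>+y. G y v \<partial>lborel) = (\<integral>\<^sup>+y. ennreal (w v) * (ennreal ((y - 0) powr (c - 1)) * indicator {s..m v} y) \<partial>lborel)"
          using v iff by (intro nn_integral_cong) (auto simp: G_def m_def mult_ac split: split_indicator)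
        also have "\<dots> = ennreal (w v) * ennreal (((m v - 0) powr c - (s - 0) powr c) / c)"
          using c st m by (subst nn_integral_cmult, measurable) (subst nn_integral_powr_shifted; simp)
        finally show ?thesis
          using True by simp
      next
        case False
        have "s / y \<le> 1" if "s \<le> y" for y
          using that st by simp
        then have "G y v = 0" for y
          using False by (force simp: G_def)
        then show ?thesis
          using False by simp
      qed
    qed
  qed
  finally have rectangle: "(\<integral>\<^sup>+y\<in>{s..t}. (\<integral>\<^sup>+z\<in>{0..s}. ennreal (power_kernel d c y z) \<partial>lborel) \<partial>lborel) =
      (\<integral>\<^sup>+v\<in>{0..1}. (ennreal (w v) * ennreal ((m v powr c - s powr c) / c)) \<partial>lborel)" .
  have "(\<integral>\<^sup>+y\<in>{s..t}. (\<integral>\<^sup>+z\<in>{0..s}. ennreal (power_kernel d c y z) \<partial>lborel) \<partial>lborel) +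
      ennreal (Beta (1 - d) (c - 1) * (s powr c / c)) =
      (\<integral>\<^sup>+v\<in>{0..1}. (ennreal (w v) * ennreal ((m v powr c - s powr c) / c)) \<partial>lborel) +
      (\<integral>\<^sup>+v\<in>{0..1}. (ennreal (w v) * ennreal (s powr c / c)) \<partial>lborel)"
  proof -
    have "(\<integral>\<^sup>+v\<in>{0..1}. (ennreal (w v) * ennreal (s powr c / c)) \<partial>lborel) =
        (\<integral>\<^sup>+v. ennreal (w v) * indicator {0..1} v * ennreal (s powr c / c) \<partial>lborel)"
      by (simp add: mult_ac)
    also have "\<dots> = (\<integral>\<^sup>+v\<in>{0..1}. ennreal (w v) \<partial>lborel) * ennreal (s powr c / c)"
      by (rule nn_integral_multc) measurable
    also have "(\<integral>\<^sup>+v\<in>{0..1}. ennreal (w v) \<partial>lborel) = ennreal (Beta (1 - d) (c - 1))"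
      using nn_integral_Beta[of "1 - d" "c - 1"] d c by (simp add: w_def)
    also have "ennreal (Beta (1 - d) (c - 1)) * ennreal (s powr c / c) = ennreal (Beta (1 - d) (c - 1) * (s powr c / c))"
      using c by (intro ennreal_mult''[symmetric]) simp
    finally show ?thesis
      by (simp only: rectangle)
  qed
  also have "\<dots> = (\<integral>\<^sup>+v. ennreal (w v) * ennreal ((m v powr c - s powr c) / c) * indicator {0..1} v +
      ennreal (w v) * ennreal (s powr c / c) * indicator {0..1} v \<partial>lborel)"
    by (rule nn_integral_add[symmetric]) measurable
  also have "\<dots> = (\<integral>\<^sup>+v\<in>{0..1}. (ennreal (w v) * ennreal (m v powr c / c)) \<partial>lborel)"
  proof (rule nn_integral_cong_AE)
    have "AE v in lborel. v \<noteq> (0 :: real)"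
      by (rule AE_lborel_singleton)
    then show "AE v in lborel. ennreal (w v) * ennreal ((m v powr c - s powr c) / c) * indicator {0..1} v +
        ennreal (w v) * ennreal (s powr c / c) * indicator {0..1} v =
        ennreal (w v) * ennreal (m v powr c / c) * indicator {0..1} v"
    proof eventually_elim
      fix v :: real assume v0: "v \<noteq> 0"
      show "ennreal (w v) * ennreal ((m v powr c - s powr c) / c) * indicator {0..1} v +
        ennreal (w v) * ennreal (s powr c / c) * indicator {0..1} v =
        ennreal (w v) * ennreal (m v powr c / c) * indicator {0..1} v"
      proof (cases "v \<in> {0..1}")
        case True
        then have v: "0 < v" "v \<le> 1"
          using v0 by auto
        have "s \<le> m v"
          using v st mult_left_le[of v s] by (auto simp: m_def field_simps)
        then have "s powr c \<le> m v powr c"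
          using st c by (intro powr_mono2) auto
        then have "ennreal ((m v powr c - s powr c) / c) + ennreal (s powr c / c) = ennreal (m v powr c / c)"
          using c by (subst ennreal_plus[symmetric]) (auto simp: diff_divide_distrib divide_right_mono)
        then show ?thesis
          using True by (simp flip: distrib_left)
      qed simp
    qed
  qed
  also have "\<dots> = (\<integral>\<^sup>+v\<in>{0..s / t}. (ennreal (w v) * ennreal (m v powr c / c)) \<partial>lborel) +
      (\<integral>\<^sup>+v\<in>{s / t..1}. (ennreal (w v) * ennreal (m v powr c / c)) \<partial>lborel)"
    using st by (intro nn_integral_split_interval) auto
  also have "(\<integral>\<^sup>+v\<in>{0..s / t}. (ennreal (w v) * ennreal (m v powr c / c)) \<partial>lborel) =
      (\<integral>\<^sup>+v. ennreal (t powr c / c) * (ennreal (w v) * indicator {0..s / t} v) \<partial>lborel)"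
  proof (rule nn_integral_cong)
    show "ennreal (w v) * ennreal (m v powr c / c) * indicator {0..s / t} v =
        ennreal (t powr c / c) * (ennreal (w v) * indicator {0..s / t} v)" for v
    proof (cases "v = 0 \<or> v \<notin> {0..s / t}")
      case True
      then show ?thesis
        by (auto simp: w_def)
    next
      case False
      then have "m v = t"
        using st by (auto simp: m_def field_simps)
      then show ?thesis
        by (simp add: mult_ac)
    qed
  qed
  also have "\<dots> = ennreal (t powr c / c) * (\<integral>\<^sup>+v\<in>{0..s / t}. ennreal (w v) \<partial>lborel)"
    by (rule nn_integral_cmult) measurable
  also have "(\<integral>\<^sup>+v\<in>{s / t..1}. (ennreal (w v) * ennreal (m v powr c / c)) \<partial>lborel) =
      (\<integral>\<^sup>+v. ennreal (s powr c / c) * (ennreal (v powr (- d - c) * (1 - v) powr (c - 2)) * indicator {s / t..1} v) \<partial>lborel)"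
  proof (rule nn_integral_cong)
    show "ennreal (w v) * ennreal (m v powr c / c) * indicator {s / t..1} v =
      ennreal (s powr c / c) * (ennreal (v powr (- d - c) * (1 - v) powr (c - 2)) * indicator {s / t..1} v)" for v
    proof (cases "v \<in> {s / t..1}")
      case True
      moreover have "0 < s / t"
        using st by simp
      ultimately have v: "0 < v" "s / t \<le> v"
        unfolding atLeastAtMost_iff by linarith+
      then have "m v = s / v"
        using st by (auto simp: m_def field_simps)
      moreover have "v powr (- d - c) = v powr (- d) / v powr c"
        by (rule powr_diff)
      ultimately have "w v * (m v powr c / c) = s powr c / c * (v powr (- d - c) * (1 - v) powr (c - 2))"
        using v st by (simp add: w_def powr_divide mult_ac)
      then have "ennreal (w v) * ennreal (m v powr c / c) =
          ennreal (s powr c / c) * ennreal (v powr (- d - c) * (1 - v) powr (c - 2))"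
        using w_nonneg[of v] c by (simp only: ennreal_mult'[symmetric]) (simp flip: ennreal_mult')
      then show ?thesis
        using True by simp
    qed simp
  qed
  also have "\<dots> = ennreal (s powr c / c) * (\<integral>\<^sup>+v\<in>{s / t..1}. ennreal (v powr (- d - c) * (1 - v) powr (c - 2)) \<partial>lborel)"
    by (rule nn_integral_cmult) measurable
  finally show ?thesis
    by (simp add: w_def add.commute)
qed

text \<open>On the rectangle \<open>y \<ge> s \<ge> z\<close>, so the absolute value in the power kernel can be dropped; the
  integral is finite as part of the trapezoid.\<close>

lemma LBINT_power_kernel_rectangle:
  assumes d: "d < 1" and c: "1 < c" and st: "0 \<le> s" "s \<le> t"
  shows "ennreal (LBINT y:{s..t}. LBINT z:{0..s}. (y / z) powr d * (y - z) powr (c - 2)) =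
    (\<integral>\<^sup>+y\<in>{s..t}. (\<integral>\<^sup>+z\<in>{0..s}. ennreal (power_kernel d c y z) \<partial>lborel) \<partial>lborel)"
proof -
  let ?J = "\<integral>\<^sup>+y\<in>{s..t}. (\<integral>\<^sup>+z\<in>{0..s}. ennreal (power_kernel d c y z) \<partial>lborel) \<partial>lborel"
  have eq: "(\<integral>\<^sup>+y\<in>{s..t}. (\<integral>\<^sup>+z\<in>{0..s}. ennreal ((y / z) powr d * (y - z) powr (c - 2)) \<partial>lborel) \<partial>lborel) = ?J"
  proof (rule nn_integral_cong)
    show "(\<integral>\<^sup>+z\<in>{0..s}. ennreal ((y / z) powr d * (y - z) powr (c - 2)) \<partial>lborel) * indicator {s..t} y =
        (\<integral>\<^sup>+z\<in>{0..s}. ennreal (power_kernel d c y z) \<partial>lborel) * indicator {s..t} y" for y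
    proof (cases "y \<in> {s..t}")
      case True
      then have "(\<integral>\<^sup>+z\<in>{0..s}. ennreal ((y / z) powr d * (y - z) powr (c - 2)) \<partial>lborel) =
          (\<integral>\<^sup>+z\<in>{0..s}. ennreal (power_kernel d c y z) \<partial>lborel)"
        by (intro nn_integral_cong) (auto simp: power_kernel_def split: split_indicator)
      then show ?thesis
        by (simp only:)
    qed simp
  qed
  have "?J < \<infinity>"
  proof -
    have "?J \<le> (\<integral>\<^sup>+y\<in>{s..t}. (\<integral>\<^sup>+z\<in>{0..y}. ennreal (power_kernel d c y z) \<partial>lborel) \<partial>lborel)"
      unfolding nn_integral_power_kernel_split[OF st, of d c] by simp
    also have "\<dots> < \<infinity>"
      unfolding nn_integral_power_kernel_trapezoid[OF d c st] by simp
    finally show ?thesis .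
  qed
  then show ?thesis
    by (subst LBINT_iterated_eq_enn2real) (measurable, auto simp: eq ennreal_enn2real)
qed

lemma LBINT_power_kernel_triangle:
  assumes d: "d < 1" and c: "1 < c" and st: "0 \<le> s" "s \<le> t"
  shows "ennreal (LBINT z:{s..t}. LBINT y:{z..t}. (y / z) powr d * (y - z) powr (c - 2)) =
    (\<integral>\<^sup>+z\<in>{s..t}. (\<integral>\<^sup>+y\<in>{z..t}. ennreal (power_kernel d c y z) \<partial>lborel) \<partial>lborel)"
proof -
  let ?J = "\<integral>\<^sup>+z\<in>{s..t}. (\<integral>\<^sup>+y\<in>{z..t}. ennreal (power_kernel d c y z) \<partial>lborel) \<partial>lborel"
  have eq: "(\<integral>\<^sup>+z\<in>{s..t}. (\<integral>\<^sup>+y\<in>{z..t}. ennreal ((y / z) powr d * (y - z) powr (c - 2)) \<partial>lborel) \<partial>lborel) = ?J"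
  proof (rule nn_integral_cong)
    show "(\<integral>\<^sup>+y\<in>{z..t}. ennreal ((y / z) powr d * (y - z) powr (c - 2)) \<partial>lborel) * indicator {s..t} z =
        (\<integral>\<^sup>+y\<in>{z..t}. ennreal (power_kernel d c y z) \<partial>lborel) * indicator {s..t} z" for z
    proof -
      have "(\<integral>\<^sup>+y\<in>{z..t}. ennreal ((y / z) powr d * (y - z) powr (c - 2)) \<partial>lborel) =
          (\<integral>\<^sup>+y\<in>{z..t}. ennreal (power_kernel d c y z) \<partial>lborel)"
        by (intro nn_integral_cong) (auto simp: power_kernel_def split: split_indicator)
      then show ?thesis
        by (simp only:)
    qed
  qed
  have "?J < \<infinity>"
  proof -
    have "?J \<le> (\<integral>\<^sup>+y\<in>{s..t}. (\<integral>\<^sup>+z\<in>{0..y}. ennreal (power_kernel d c y z) \<partial>lborel) \<partial>lborel)"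
      unfolding nn_integral_power_kernel_split[OF st, of d c] by simp
    also have "\<dots> < \<infinity>"
      unfolding nn_integral_power_kernel_trapezoid[OF d c st] by simp
    finally show ?thesis .
  qed
  then show ?thesis
    by (subst LBINT_iterated_eq_enn2real) (measurable, auto simp: eq ennreal_enn2real)
qed

section \<open>Decomposition of the covariance\<close>

text \<open>For \<open>s \<le> t\<close> the rectangle \<open>[0, t] \<times> [0, s]\<close> consists of the two triangles of \<open>[0, s]\<^sup>2\<close> and of
  \<open>[s, t] \<times> [0, s]\<close>. Reflection at the diagonal replaces \<open>d\<close> by \<open>-d\<close> in the power kernel.\<close>

lemma nn_integral_cov_density:
  fixes a b s t :: real
  assumes a: "1 / 2 < a" "a < 1" and b: "1 / 2 < b" "b < 1" and st: "0 \<le> s" "s \<le> t"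
  defines "P \<equiv> Beta (b - 1 / 2) (2 - a - b)" and "Q \<equiv> Beta (a - 1 / 2) (2 - a - b)"
  shows "(\<integral>\<^sup>+y\<in>{0..t}. (\<integral>\<^sup>+z\<in>{0..s}. ennreal (cov_density a b y z) \<partial>lborel) \<partial>lborel) =
    ennreal P * ennreal (Beta (1 - (a - b)) (a + b - 1) * (s powr (a + b) / (a + b))) +
    ennreal Q * ennreal (Beta (1 + (a - b)) (a + b - 1) * (s powr (a + b) / (a + b))) +
    ennreal P * (\<integral>\<^sup>+y\<in>{s..t}. (\<integral>\<^sup>+z\<in>{0..s}. ennreal (power_kernel (a - b) (a + b) y z) \<partial>lborel) \<partial>lborel)"
proof -
  let ?d = "a - b" and ?c = "a + b"
  let ?k = "\<lambda>y z. ennreal (power_kernel ?d ?c y z)"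
  let ?f = "\<lambda>y z. ennreal (cov_density a b y z)"
  have PQ: "0 \<le> P" "0 \<le> Q"
    unfolding P_def Q_def using a b by (auto intro!: less_imp_le[OF Beta_pos])
  have d: "?d < 1" "- ?d < 1" and c: "1 < ?c"
    using a b by auto
  have below: "(\<integral>\<^sup>+z\<in>A. ?f y z \<partial>lborel) = ennreal P * (\<integral>\<^sup>+z\<in>A. ?k y z \<partial>lborel)"
    if [measurable]: "A \<in> sets borel" and A: "\<And>z. z \<in> A \<Longrightarrow> z \<le> y" for A y
  proof -
    have "(\<integral>\<^sup>+z\<in>A. ?f y z \<partial>lborel) = (\<integral>\<^sup>+z. ennreal P * (?k y z * indicator A z) \<partial>lborel)"
    proof (rule nn_integral_cong_AE)
      show "AE z in lborel. ?f y z * indicator A z = ennreal P * (?k y z * indicator A z)"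
        using AE_lborel_singleton[of y]
      proof eventually_elim
        case (elim z)
        then have "cov_density a b y z = P * power_kernel ?d ?c y z" if "z \<in> A"
          using A[OF that] by (simp add: cov_density_def power_kernel_def P_def)
        then show ?case
          using PQ by (auto split: split_indicator simp: ennreal_mult')
      qed
    qed
    then show ?thesis
      by (simp add: nn_integral_cmult)
  qed
  have above: "(\<integral>\<^sup>+z\<in>A. ?f y z \<partial>lborel) = ennreal Q * (\<integral>\<^sup>+z\<in>A. ?k y z \<partial>lborel)"
    if [measurable]: "A \<in> sets borel" and A: "\<And>z. z \<in> A \<Longrightarrow> y \<le> z" for A y
  proof -
    have "(\<integral>\<^sup>+z\<in>A. ?f y z \<partial>lborel) = (\<integral>\<^sup>+z. ennreal Q * (?k y z * indicator A z) \<partial>lborel)"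
    proof (rule nn_integral_cong_AE)
      show "AE z in lborel. ?f y z * indicator A z = ennreal Q * (?k y z * indicator A z)"
        using AE_lborel_singleton[of y]
      proof eventually_elim
        case (elim z)
        then have "cov_density a b y z = Q * power_kernel ?d ?c y z" if "z \<in> A"
          using A[OF that] by (simp add: cov_density_def power_kernel_def Q_def)
        then show ?case
          using PQ by (auto split: split_indicator simp: ennreal_mult')
      qed
    qed
    then show ?thesis
      by (simp add: nn_integral_cmult)
  qed
  have lower: "(\<integral>\<^sup>+y\<in>{0..s}. (\<integral>\<^sup>+z\<in>{0..y}. ?k y z \<partial>lborel) \<partial>lborel) =
      ennreal (Beta (1 - ?d) (?c - 1) * (s powr ?c / ?c))"
    using nn_integral_power_kernel_trapezoid[OF d(1) c, of 0 s] st c by simp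
  \<comment> \<open>this triangle is swept the wrong way; exchanging the variables makes it a trapezoid for \<open>- d\<close>\<close>
  have upper: "(\<integral>\<^sup>+y\<in>{0..s}. (\<integral>\<^sup>+z\<in>{y..s}. ?k y z \<partial>lborel) \<partial>lborel) =
      ennreal (Beta (1 + ?d) (?c - 1) * (s powr ?c / ?c))"
  proof -
    have "(\<integral>\<^sup>+y\<in>{0..s}. (\<integral>\<^sup>+z\<in>{y..s}. ?k y z \<partial>lborel) \<partial>lborel) =
        (\<integral>\<^sup>+z\<in>{0..s}. (\<integral>\<^sup>+y\<in>{0..z}. ?k y z \<partial>lborel) \<partial>lborel)"
      by (rule nn_integral_triangle_swap[symmetric]) measurable
    also have "\<dots> = (\<integral>\<^sup>+z\<in>{0..s}. (\<integral>\<^sup>+y\<in>{0..z}. ennreal (power_kernel (- ?d) ?c z y) \<partial>lborel) \<partial>lborel)"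
    proof (rule nn_integral_cong)
      show "(\<integral>\<^sup>+y\<in>{0..z}. ?k y z \<partial>lborel) * indicator {0..s} z =
          (\<integral>\<^sup>+y\<in>{0..z}. ennreal (power_kernel (- ?d) ?c z y) \<partial>lborel) * indicator {0..s} z" for z
      proof -
        have "(\<integral>\<^sup>+y\<in>{0..z}. ?k y z \<partial>lborel) = (\<integral>\<^sup>+y\<in>{0..z}. ennreal (power_kernel (- ?d) ?c z y) \<partial>lborel)"
          by (intro nn_integral_cong) (auto split: split_indicator simp: power_kernel_swap[of _ z])
        then show ?thesis
          by (simp only:)
      qed
    qed
    also have "\<dots> = ennreal (Beta (1 - - ?d) (?c - 1) * ((s powr ?c - 0 powr ?c) / ?c))"
      using st by (intro nn_integral_power_kernel_trapezoid d c) auto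
    finally show ?thesis
      unfolding diff_minus_eq_add using c by simp
  qed
  have "(\<integral>\<^sup>+y\<in>{0..t}. (\<integral>\<^sup>+z\<in>{0..s}. ?f y z \<partial>lborel) \<partial>lborel) =
      (\<integral>\<^sup>+y\<in>{0..s}. (\<integral>\<^sup>+z\<in>{0..s}. ?f y z \<partial>lborel) \<partial>lborel) +
      (\<integral>\<^sup>+y\<in>{s..t}. (\<integral>\<^sup>+z\<in>{0..s}. ?f y z \<partial>lborel) \<partial>lborel)"
    using st by (intro nn_integral_split_interval) auto
  also have "(\<integral>\<^sup>+y\<in>{s..t}. (\<integral>\<^sup>+z\<in>{0..s}. ?f y z \<partial>lborel) \<partial>lborel) =
      (\<integral>\<^sup>+y. ennreal P * ((\<integral>\<^sup>+z\<in>{0..s}. ?k y z \<partial>lborel) * indicator {s..t} y) \<partial>lborel)"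
  proof (rule nn_integral_cong)
    show "(\<integral>\<^sup>+z\<in>{0..s}. ?f y z \<partial>lborel) * indicator {s..t} y =
        ennreal P * ((\<integral>\<^sup>+z\<in>{0..s}. ?k y z \<partial>lborel) * indicator {s..t} y)" for y
      using below[of "{0..s}" y] by (cases "y \<in> {s..t}") (auto simp: mult.assoc)
  qed
  also have "\<dots> = ennreal P * (\<integral>\<^sup>+y\<in>{s..t}. (\<integral>\<^sup>+z\<in>{0..s}. ?k y z \<partial>lborel) \<partial>lborel)"
    by (rule nn_integral_cmult) measurable
  also have "(\<integral>\<^sup>+y\<in>{0..s}. (\<integral>\<^sup>+z\<in>{0..s}. ?f y z \<partial>lborel) \<partial>lborel) =
      (\<integral>\<^sup>+y. ennreal P * ((\<integral>\<^sup>+z\<in>{0..y}. ?k y z \<partial>lborel) * indicator {0..s} y) +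
            ennreal Q * ((\<integral>\<^sup>+z\<in>{y..s}. ?k y z \<partial>lborel) * indicator {0..s} y) \<partial>lborel)"
  proof (rule nn_integral_cong)
    show "(\<integral>\<^sup>+z\<in>{0..s}. ?f y z \<partial>lborel) * indicator {0..s} y =
        ennreal P * ((\<integral>\<^sup>+z\<in>{0..y}. ?k y z \<partial>lborel) * indicator {0..s} y) +
        ennreal Q * ((\<integral>\<^sup>+z\<in>{y..s}. ?k y z \<partial>lborel) * indicator {0..s} y)" for y
    proof (cases "y \<in> {0..s}")
      case True
      then have "(\<integral>\<^sup>+z\<in>{0..s}. ?f y z \<partial>lborel) = (\<integral>\<^sup>+z\<in>{0..y}. ?f y z \<partial>lborel) + (\<integral>\<^sup>+z\<in>{y..s}. ?f y z \<partial>lborel)"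
        by (intro nn_integral_split_interval) auto
      then show ?thesis
        using True below[of "{0..y}" y] above[of "{y..s}" y] by simp
    qed simp
  qed
  also have "\<dots> = (\<integral>\<^sup>+y. ennreal P * ((\<integral>\<^sup>+z\<in>{0..y}. ?k y z \<partial>lborel) * indicator {0..s} y) \<partial>lborel) +
      (\<integral>\<^sup>+y. ennreal Q * ((\<integral>\<^sup>+z\<in>{y..s}. ?k y z \<partial>lborel) * indicator {0..s} y) \<partial>lborel)"
    by (rule nn_integral_add) measurable
  also have "(\<integral>\<^sup>+y. ennreal P * ((\<integral>\<^sup>+z\<in>{0..y}. ?k y z \<partial>lborel) * indicator {0..s} y) \<partial>lborel) =
      ennreal P * (\<integral>\<^sup>+y\<in>{0..s}. (\<integral>\<^sup>+z\<in>{0..y}. ?k y z \<partial>lborel) \<partial>lborel)"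
    by (rule nn_integral_cmult) measurable
  also have "(\<integral>\<^sup>+y. ennreal Q * ((\<integral>\<^sup>+z\<in>{y..s}. ?k y z \<partial>lborel) * indicator {0..s} y) \<partial>lborel) =
      ennreal Q * (\<integral>\<^sup>+y\<in>{0..s}. (\<integral>\<^sup>+z\<in>{y..s}. ?k y z \<partial>lborel) \<partial>lborel)"
    by (rule nn_integral_cmult) measurable
  finally show ?thesis
    unfolding lower upper .
qed

text \<open>Both sides are the integral over \<open>u\<close> of the product of the two kernels, whose order is irrelevant.\<close>

lemma nn_integral_cov_density_commute:
  assumes "1 / 2 < a" "1 / 2 < b" "a + b < 2"
  shows "(\<integral>\<^sup>+y\<in>{0..t}. (\<integral>\<^sup>+z\<in>{0..s}. ennreal (cov_density a b y z) \<partial>lborel) \<partial>lborel) =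
    (\<integral>\<^sup>+y\<in>{0..s}. (\<integral>\<^sup>+z\<in>{0..t}. ennreal (cov_density b a y z) \<partial>lborel) \<partial>lborel)"
proof -
  let ?A = "\<lambda>u. \<integral>\<^sup>+y\<in>{u..t}. ennreal ((y - u) powr (a - 3 / 2) * y powr (a - 1 / 2)) \<partial>lborel"
  let ?B = "\<lambda>u. \<integral>\<^sup>+z\<in>{u..s}. ennreal ((z - u) powr (b - 3 / 2) * z powr (b - 1 / 2)) \<partial>lborel"
  have "(\<integral>\<^sup>+y\<in>{0..t}. (\<integral>\<^sup>+z\<in>{0..s}. ennreal (cov_density a b y z) \<partial>lborel) \<partial>lborel) =
      (\<integral>\<^sup>+u\<in>{0..min s t}. (ennreal (u powr (1 - a - b)) * (?A u * ?B u)) \<partial>lborel)"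
    using assms by (intro nn_integral_covariance[symmetric])
  also have "\<dots> = (\<integral>\<^sup>+u\<in>{0..min t s}. (ennreal (u powr (1 - b - a)) * (?B u * ?A u)) \<partial>lborel)"
  proof -
    have "1 - a - b = 1 - b - a"
      by simp
    then show ?thesis
      by (simp only: min.commute[of s t] mult.commute[of "?A _"])
  qed
  also have "\<dots> = (\<integral>\<^sup>+y\<in>{0..s}. (\<integral>\<^sup>+z\<in>{0..t}. ennreal (cov_density b a y z) \<partial>lborel) \<partial>lborel)"
    using assms by (intro nn_integral_covariance) auto
  finally show ?thesis .
qed

lemma nn_integral_cov_density_finite:
  assumes a: "1 / 2 < a" "a < 1" and b: "1 / 2 < b" "b < 1" and "0 \<le> s" "0 \<le> t"
  shows "(\<integral>\<^sup>+y\<in>{0..t}. (\<integral>\<^sup>+z\<in>{0..s}. ennreal (cov_density a b y z) \<partial>lborel) \<partial>lborel) < \<infinity>"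
proof -
  have ordered: "(\<integral>\<^sup>+y\<in>{0..t}. (\<integral>\<^sup>+z\<in>{0..s}. ennreal (cov_density a b y z) \<partial>lborel) \<partial>lborel) < \<infinity>"
    if "1 / 2 < a" "a < 1" "1 / 2 < b" "b < 1" "0 \<le> s" "s \<le> t" for a b s t
  proof -
    have "a - b < 1" "1 < a + b"
      using that by auto
    note rectangle = LBINT_power_kernel_rectangle[OF this that(5,6), symmetric]
    show ?thesis
      unfolding nn_integral_cov_density[OF that] rectangle by (simp add: ennreal_mult_less_top)
  qed
  show ?thesis
  proof (cases "s \<le> t")
    case True
    then show ?thesis
      using assms by (intro ordered)
  next
    case False
    then have "(\<integral>\<^sup>+y\<in>{0..s}. (\<integral>\<^sup>+z\<in>{0..t}. ennreal (cov_density b a y z) \<partial>lborel) \<partial>lborel) < \<infinity>"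
      using assms by (intro ordered) auto
    then show ?thesis
      using assms by (subst nn_integral_cov_density_commute) auto
  qed
qed

context
  fixes H :: "real \<Rightarrow> real"
  assumes H_range: "H \<in> {0..} \<rightarrow> {1/2<..<1}"
begin

lemma H_bounds: "0 \<le> t \<Longrightarrow> 1 / 2 < H t" "0 \<le> t \<Longrightarrow> H t < 1"
  using H_range by auto

lemma beta_nonneg:
  assumes "0 \<le> s" "0 \<le> t"
  shows "0 \<le> beta1 H t s" "0 \<le> beta2 H t s"
  using H_bounds[OF assms(1)] H_bounds[OF assms(2)]
  by (auto simp: beta1_def beta2_def intro!: less_imp_le[OF Beta_pos])

lemma R_H_rectangle:
  assumes st: "0 \<le> s" "s \<le> t"
  shows "R_H H t s = c_prod H t s *
          (beta_tilde H t s * (s powr (H t + H s) / (H t + H s)) +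
           beta1 H s t *
             (LBINT y:{s..t}. LBINT z:{0..s}. (y / z) powr (H t - H s) * (y - z) powr (H t + H s - 2)))"
proof -
  let ?J = "LBINT y:{s..t}. LBINT z:{0..s}. (y / z) powr (H t - H s) * (y - z) powr (H t + H s - 2)"
  have t: "0 \<le> t"
    using st by simp
  note bounds = H_bounds[OF st(1)] H_bounds[OF t]
  have J: "0 \<le> ?J"
    unfolding set_lebesgue_integral_def by (intro Bochner_Integration.integral_nonneg) auto
  have pos: "0 \<le> s powr (H t + H s) / (H t + H s)"
    using bounds by simp
  have "(\<integral>\<^sup>+y\<in>{0..t}. (\<integral>\<^sup>+z\<in>{0..s}. ennreal (cov_density (H t) (H s) y z) \<partial>lborel) \<partial>lborel) =
    ennreal (beta1 H s t) * ennreal (beta2 H s t * (s powr (H t + H s) / (H t + H s))) +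
    ennreal (beta1 H t s) * ennreal (beta2 H t s * (s powr (H t + H s) / (H t + H s))) +
    ennreal (beta1 H s t) * ennreal ?J"
  proof -
    have "Beta (H s - 1 / 2) (2 - H t - H s) = beta1 H s t" "Beta (H t - 1 / 2) (2 - H t - H s) = beta1 H t s"
      "Beta (1 - (H t - H s)) (H t + H s - 1) = beta2 H s t" "Beta (1 + (H t - H s)) (H t + H s - 1) = beta2 H t s"
      by (simp_all add: beta1_def beta2_def algebra_simps)
    moreover have "H t - H s < 1" "1 < H t + H s"
      using bounds by auto
    ultimately show ?thesis
      using nn_integral_cov_density[of "H t" "H s" s t] bounds st
      by (simp only: LBINT_power_kernel_rectangle)
  qed
  also have "\<dots> = ennreal (beta1 H s t * (beta2 H s t * (s powr (H t + H s) / (H t + H s))) +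
      beta1 H t s * (beta2 H t s * (s powr (H t + H s) / (H t + H s))) + beta1 H s t * ?J)"
  proof -
    have alg: "ennreal x * ennreal u + ennreal y * ennreal v + ennreal x * ennreal j = ennreal (x * u + y * v + x * j)"
      if "0 \<le> x" "0 \<le> y" "0 \<le> u" "0 \<le> v" "0 \<le> j" for x y u v j :: real
      using that by (simp add: ennreal_mult')
    show ?thesis
      using beta_nonneg[OF st(1) t] beta_nonneg[OF t st(1)] J pos
      by (intro alg mult_nonneg_nonneg)
  qed
  also have "beta1 H s t * (beta2 H s t * (s powr (H t + H s) / (H t + H s))) +
      beta1 H t s * (beta2 H t s * (s powr (H t + H s) / (H t + H s))) + beta1 H s t * ?J =
      beta_tilde H t s * (s powr (H t + H s) / (H t + H s)) + beta1 H s t * ?J"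
    by (simp add: beta_tilde_def algebra_simps add_divide_distrib)
  finally have "(\<integral>\<^sup>+y\<in>{0..t}. (\<integral>\<^sup>+z\<in>{0..s}. ennreal (cov_density (H t) (H s) y z) \<partial>lborel) \<partial>lborel) =
      ennreal (beta_tilde H t s * (s powr (H t + H s) / (H t + H s)) + beta1 H s t * ?J)" .
  moreover have "0 \<le> beta_tilde H t s * (s powr (H t + H s) / (H t + H s)) + beta1 H s t * ?J"
    using beta_nonneg[OF st(1) t] beta_nonneg[OF t st(1)] J pos unfolding beta_tilde_def
    by (intro add_nonneg_nonneg mult_nonneg_nonneg)
  ultimately show ?thesis
    using R_H_eq_nn_integral[of H t s] bounds by (simp only: enn2real_ennreal)
qed

text \<open>The rectangle in \<open>R_H_rectangle\<close> is a trapezoid minus a triangle.\<close>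

lemma R_H_triangle:
  assumes st: "0 \<le> s" "s \<le> t"
  shows "R_H H t s = c_prod H t s *
          (beta1 H t s * beta2 H t s / (H t + H s) * s powr (H t + H s) +
           beta1 H s t * beta2 H s t / (H t + H s) * t powr (H t + H s) -
           beta1 H s t *
             (LBINT z:{s..t}. LBINT y:{z..t}.
                (y / z) powr (H t - H s) * (y - z) powr (H s + H t - 2)))"
proof -
  let ?J = "LBINT y:{s..t}. LBINT z:{0..s}. (y / z) powr (H t - H s) * (y - z) powr (H t + H s - 2)"
  let ?L = "LBINT z:{s..t}. LBINT y:{z..t}. (y / z) powr (H t - H s) * (y - z) powr (H t + H s - 2)"
  have t: "0 \<le> t"
    using st by simp
  note bounds = H_bounds[OF st(1)] H_bounds[OF t]
  have d: "H t - H s < 1" and c: "1 < H t + H s"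
    using bounds by auto
  have J: "0 \<le> ?J" "0 \<le> ?L"
    unfolding set_lebesgue_integral_def by (intro Bochner_Integration.integral_nonneg; auto)+
  have mono: "s powr (H t + H s) \<le> t powr (H t + H s)"
    using st bounds by (intro powr_mono2) auto
  have "ennreal (?J + ?L) = ennreal (beta2 H s t * ((t powr (H t + H s) - s powr (H t + H s)) / (H t + H s)))"
  proof -
    have "Beta (1 - (H t - H s)) (H t + H s - 1) = beta2 H s t"
      by (simp add: beta2_def algebra_simps)
    moreover have "ennreal (?J + ?L) = ennreal ?J + ennreal ?L"
      using J by (rule ennreal_plus)
    ultimately show ?thesis
      using nn_integral_power_kernel_split[OF st, of "H t - H s" "H t + H s"]
      by (simp only: LBINT_power_kernel_rectangle[OF d c st] LBINT_power_kernel_triangle[OF d c st]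
          nn_integral_power_kernel_trapezoid[OF d c st])
  qed
  then have "?J + ?L = beta2 H s t * ((t powr (H t + H s) - s powr (H t + H s)) / (H t + H s))"
    using J mono beta_nonneg[OF t st(1)] bounds by (subst (asm) ennreal_inj) auto
  then have J_eq: "?J = beta2 H s t * ((t powr (H t + H s) - s powr (H t + H s)) / (H t + H s)) - ?L"
    by simp
  have alg: "(u + b * b2) * (S / c) + b * (b2 * ((T - S) / c) - L) = u / c * S + b * b2 / c * T - b * L"
    for u b b2 S T L c :: real
    by (simp add: algebra_simps diff_divide_distrib)
  show ?thesis
    unfolding R_H_rectangle[OF st] J_eq beta_tilde_def alg add.commute[of "H s" "H t"] ..
qed

text \<open>The triangle \<open>0 < z < y < s\<close> contributes \<open>beta1 H s t * beta2 H s t * s^c / c\<close>, which is exactly the term that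
  the rectangle is missing in \<open>nn_integral_power_kernel_rectangle\<close>. At \<open>s = 0\<close> the first integral
  diverges; it is multiplied by \<open>0\<close>, and all other terms vanish as well.\<close>

lemma R_H_incomplete_Beta:
  assumes st: "0 \<le> s" "s \<le> t" "0 < t"
  shows "R_H H t s = c_prod H t s / (H t + H s) *
          (beta1 H t s * beta2 H t s * s powr (H t + H s) +
           beta1 H s t *
             (s powr (H t + H s) *
                (LBINT v:{s / t..1}. v powr (- 2 * H t) * (1 - v) powr (H s + H t - 2)) +
              t powr (H t + H s) *
                (LBINT v:{0..s / t}. v powr (H s - H t) * (1 - v) powr (H s + H t - 2))))"
proof (cases "s = 0")
  case True
  then show ?thesis
    using st by (simp add: R_H_def LBINT_singleton)
next
  case False
  then have s: "0 < s"
    using st by simp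
  have t: "0 \<le> t"
    using st by simp
  note bounds = H_bounds[OF st(1)] H_bounds[OF t]
  define c where "c = H t + H s"
  define d where "d = H t - H s"
  have d: "d < 1" and c: "1 < c"
    using bounds by (auto simp: c_def d_def)
  define J where "J = (LBINT y:{s..t}. LBINT z:{0..s}. (y / z) powr d * (y - z) powr (c - 2))"
  have J: "0 \<le> J"
    unfolding J_def set_lebesgue_integral_def by (intro Bochner_Integration.integral_nonneg) auto
  let ?f = "\<lambda>v. v powr (- d - c) * (1 - v) powr (c - 2)" and ?g = "\<lambda>v. v powr (- d) * (1 - v) powr (c - 2)"
  define I1 where "I1 = (LBINT v:{s / t..1}. ?f v)"
  define I2 where "I2 = (LBINT v:{0..s / t}. ?g v)"
  have B: "0 \<le> beta2 H s t * (s powr c / c)"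
    using beta_nonneg[OF t st(1)] c by simp
  have eq: "ennreal (J + beta2 H s t * (s powr c / c)) =
    ennreal (s powr c / c) * (\<integral>\<^sup>+v\<in>{s / t..1}. ennreal (?f v) \<partial>lborel) +
    ennreal (t powr c / c) * (\<integral>\<^sup>+v\<in>{0..s / t}. ennreal (?g v) \<partial>lborel)" (is "_ = _ * ?N1 + _ * ?N2")
  proof -
    have "Beta (1 - d) (c - 1) = beta2 H s t"
      by (simp add: beta2_def c_def d_def algebra_simps)
    then show ?thesis
      using nn_integral_power_kernel_rectangle[OF d c s st(2)] J B
      unfolding LBINT_power_kernel_rectangle[OF d c st(1,2), symmetric] J_def[symmetric] by simp
  qed
  have "?N1 < \<infinity>" "?N2 < \<infinity>"
  proof -
    have "ennreal (s powr c / c) * ?N1 + ennreal (t powr c / c) * ?N2 < \<infinity>"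
      unfolding eq[symmetric] by simp
    moreover have "0 < s powr c / c" "0 < t powr c / c"
      using s st c by auto
    ultimately show "?N1 < \<infinity>" "?N2 < \<infinity>"
      by (auto simp: ennreal_mult_less_top)
  qed
  moreover have "I1 = enn2real ?N1" "I2 = enn2real ?N2"
    unfolding I1_def I2_def by (rule LBINT_eq_enn2real; simp)+
  ultimately have N: "?N1 = ennreal I1" "?N2 = ennreal I2" "0 \<le> I1" "0 \<le> I2"
    by (auto simp: ennreal_enn2real)
  have "J + beta2 H s t * (s powr c / c) = s powr c / c * I1 + t powr c / c * I2"
  proof -
    have alg: "ennreal x * ennreal u + ennreal y * ennreal v = ennreal (x * u + y * v)"
      if "0 \<le> x" "0 \<le> y" "0 \<le> u" "0 \<le> v" for x y u v :: real
      using that by (simp add: ennreal_mult')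
    have "ennreal (J + beta2 H s t * (s powr c / c)) = ennreal (s powr c / c * I1 + t powr c / c * I2)"
      unfolding eq N(1,2) using N(3,4) c by (intro alg) auto
    then show ?thesis
      using J B N c by (subst (asm) ennreal_inj) auto
  qed
  then have J_eq: "J = (s powr c * I1 + t powr c * I2) / c - beta2 H s t * s powr c / c"
    by (simp add: add_divide_distrib algebra_simps)
  have exps: "- 2 * H t = - d - c" "H s - H t = - d" "H s + H t - 2 = c - 2" "H t + H s = c"
    by (simp_all add: c_def d_def)
  have "R_H H t s = c_prod H t s * (beta_tilde H t s * (s powr c / c) + beta1 H s t * J)"
    using R_H_rectangle[OF st(1,2)] unfolding J_def c_def d_def .
  also have "\<dots> = c_prod H t s / c * (beta1 H t s * beta2 H t s * s powr c +
      beta1 H s t * (s powr c * I1 + t powr c * I2))"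
    unfolding J_eq beta_tilde_def using c by (simp add: field_simps)
  finally show ?thesis
    unfolding exps I1_def I2_def .
qed

text \<open>Of the two incomplete Beta integrals, the first is already taken over \<open>[s/t, 1]\<close>, and the second is the
  complete one minus its part over \<open>[s/t, 1]\<close>. Both prefactors reduce to
  \<open>T = t (t-s)^(c-1) (t/s)^d\<close>, since \<open>2 H t = c + d\<close>.\<close>

lemma R_H_hypergeometric:
  assumes st: "0 < s" "s \<le> t"
  shows "complex_of_real (R_H H t s) = complex_of_real (c_prod H t s / (H t + H s)) *
          (complex_of_real (beta1 H t s * beta2 H t s * s powr (H t + H s)) +
           complex_of_real (beta1 H s t * beta2 H s t * t powr (H t + H s)) +
           complex_of_real (beta1 H s t * t * (t - s) powr (H t + H s - 1) / (H t + H s - 1) *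
               (t / s) powr (H t - H s)) *
             (hyp2F1 1 (complex_of_real (2 * H t)) (complex_of_real (H s + H t))
                (complex_of_real ((s - t) / s)) -
              hyp2F1 1 (complex_of_real (H t - H s)) (complex_of_real (H s + H t))
                (complex_of_real ((s - t) / s))))"
proof -
  have s: "0 \<le> s" and t: "0 \<le> t"
    using st by auto
  note bounds = H_bounds[OF s] H_bounds[OF t]
  define c where "c = H t + H s"
  define d where "d = H t - H s"
  define x where "x = s / t"
  have d: "d < 1" and c: "1 < c"
    using bounds by (auto simp: c_def d_def)
  have x: "0 < x" "x \<le> 1"
    using st by (auto simp: x_def)
  have arg: "(s - t) / s = 1 - 1 / x"
    using st by (simp add: x_def diff_divide_distrib)
  obtain F1 where F1: "hyp2F1 1 (of_real (2 * H t)) (of_real c) (of_real (1 - 1 / x)) = of_real F1"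
    and V1: "((\<lambda>v. v powr (- (2 * H t)) * (1 - v) powr (c - 2)) has_integral
          (1 - x) powr (c - 1) * x powr (- (2 * H t)) / (c - 1) * F1) {x..1}"
    by (rule incomplete_Beta_eq_hyp2F1[OF c x, of "2 * H t"])
  obtain F2 where F2: "hyp2F1 1 (of_real d) (of_real c) (of_real (1 - 1 / x)) = of_real F2"
    and V2: "((\<lambda>v. v powr (- d) * (1 - v) powr (c - 2)) has_integral
          (1 - x) powr (c - 1) * x powr (- d) / (c - 1) * F2) {x..1}" (is "(?g has_integral ?V2) _")
    by (rule incomplete_Beta_eq_hyp2F1[OF c x, of d])
  define T where "T = t * (t - s) powr (c - 1) * (t / s) powr d"
  define Q where "Q = T / (c - 1)"
  have T_d: "t powr c * ((1 - x) powr (c - 1) * x powr (- d)) = T"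
  proof -
    have "1 - x = (t - s) / t"
      using st by (simp add: x_def diff_divide_distrib)
    then have "(1 - x) powr (c - 1) = (t - s) powr (c - 1) / t powr (c - 1)"
      using st by (simp add: powr_divide)
    moreover have "t powr c = t * t powr (c - 1)"
      using st powr_add[of t 1 "c - 1"] by simp
    moreover have "x powr (- d) = (t / s) powr d"
      using powr_ratio_swap[OF t s, of d] by (simp add: x_def)
    ultimately show ?thesis
      using st by (simp add: T_def)
  qed
  have T_2H: "s powr c * ((1 - x) powr (c - 1) * x powr (- (2 * H t))) = T"
  proof -
    have "- (2 * H t) = - c + - d"
      by (simp add: c_def d_def)
    then have "x powr (- (2 * H t)) = x powr (- c) * x powr (- d)"
      by (simp only: powr_add)
    moreover have "x powr (- c) = (t / s) powr c"
      unfolding x_def by (rule powr_ratio_swap[OF t s, symmetric])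
    then have "s powr c * x powr (- c) = t powr c"
      using st by (simp add: powr_divide)
    ultimately show ?thesis
      unfolding T_d[symmetric] by (simp add: mult_ac)
  qed
  have I1: "(LBINT v:{x..1}. v powr (- (2 * H t)) * (1 - v) powr (c - 2)) =
      (1 - x) powr (c - 1) * x powr (- (2 * H t)) / (c - 1) * F1"
    by (rule LBINT_eq_of_has_integral[OF _ _ _ V1]) auto
  have I2: "(LBINT v:{0..x}. ?g v) = beta2 H s t - ?V2"
  proof -
    have B: "((\<lambda>v. ?g v) has_integral beta2 H s t) {0..1}"
      using has_integral_Beta_real[of "1 - d" "c - 1"] d c
      by (simp add: beta2_def c_def d_def algebra_simps)
    have "?g integrable_on {0..1}"
      using B by (rule has_integral_integrable)
    then have "?g integrable_on {0..x}"
      by (rule integrable_on_subinterval) (use x in auto)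
    then obtain I where I: "(?g has_integral I) {0..x}"
      unfolding integrable_on_def by (elim exE)
    have "(?g has_integral I + ?V2) {0..1}"
      by (rule has_integral_combine[OF _ _ I V2]) (use x in auto)
    then have "I + ?V2 = beta2 H s t"
      using B by (rule has_integral_unique)
    moreover have "(LBINT v:{0..x}. ?g v) = I"
      by (rule LBINT_eq_of_has_integral[OF _ _ _ I]) auto
    ultimately show ?thesis
      by simp
  qed
  have exps: "- 2 * H t = - (2 * H t)" "H s - H t = - d" "H s + H t = c" "H t + H s = c" "H t - H s = d"
    by (simp_all add: c_def d_def)
  have "R_H H t s = c_prod H t s / c * (beta1 H t s * beta2 H t s * s powr c + beta1 H s t *
      (s powr c * ((1 - x) powr (c - 1) * x powr (- (2 * H t)) / (c - 1) * F1) +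
       t powr c * (beta2 H s t - ?V2)))"
    using R_H_incomplete_Beta[of s t] st s
    unfolding exps x_def[symmetric] I1 I2 by simp
  also have "s powr c * ((1 - x) powr (c - 1) * x powr (- (2 * H t)) / (c - 1) * F1) = Q * F1"
    unfolding Q_def T_2H[symmetric] by simp
  also have "t powr c * (beta2 H s t - ?V2) = t powr c * beta2 H s t - Q * F2"
    unfolding Q_def T_d[symmetric] by (simp add: right_diff_distrib mult_ac)
  also have "beta1 H t s * beta2 H t s * s powr c + beta1 H s t * (Q * F1 + (t powr c * beta2 H s t - Q * F2)) =
      beta1 H t s * beta2 H t s * s powr c + beta1 H s t * beta2 H s t * t powr c + (beta1 H s t * Q) * (F1 - F2)"
    by (simp add: algebra_simps)
  also have "beta1 H s t * Q = beta1 H s t * t * (t - s) powr (c - 1) / (c - 1) * (t / s) powr d"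
    by (simp add: Q_def T_def)
  finally have "R_H H t s = c_prod H t s / c * (beta1 H t s * beta2 H t s * s powr c +
      beta1 H s t * beta2 H s t * t powr c +
      beta1 H s t * t * (t - s) powr (c - 1) / (c - 1) * (t / s) powr d * (F1 - F2))"
    .
  then show ?thesis
    unfolding exps arg F1 F2 of_real_add[symmetric] of_real_mult[symmetric] of_real_diff[symmetric]
    by (rule arg_cong[where f = complex_of_real])
qed

lemma R_H_double_integral:
  assumes s: "0 \<le> s" and t: "0 \<le> t"
  shows "R_H H t s = c_prod H t s *
          (LBINT y:{0..t}. LBINT z:{0..s}.
             (beta1 H s t * of_bool (y > z) + beta1 H t s * of_bool (y < z)) *
             (y / z) powr (H t - H s) * \<bar>y - z\<bar> powr (H s + H t - 2))"
proof -
  note bounds = H_bounds[OF s] H_bounds[OF t]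
  have density: "(beta1 H s t * of_bool (y > z) + beta1 H t s * of_bool (y < z)) *
      (y / z) powr (H t - H s) * \<bar>y - z\<bar> powr (H s + H t - 2) = cov_density (H t) (H s) y z" for y z
  proof -
    have "2 - H s - H t = 2 - H t - H s"
      by simp
    then show ?thesis
      unfolding cov_density_def beta1_def by (simp only: add.commute[of "H s" "H t"])
  qed
  have nonneg: "0 \<le> cov_density (H t) (H s) y z" for y z
    unfolding density[symmetric] using beta_nonneg[OF s t] beta_nonneg[OF t s] by simp
  have "(\<integral>\<^sup>+y\<in>{0..t}. (\<integral>\<^sup>+z\<in>{0..s}. ennreal (cov_density (H t) (H s) y z) \<partial>lborel) \<partial>lborel) < \<infinity>"
    using bounds s t by (intro nn_integral_cov_density_finite) auto
  then have "(LBINT y:{0..t}. LBINT z:{0..s}. cov_density (H t) (H s) y z) =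
      enn2real (\<integral>\<^sup>+y\<in>{0..t}. (\<integral>\<^sup>+z\<in>{0..s}. ennreal (cov_density (H t) (H s) y z) \<partial>lborel) \<partial>lborel)"
    by (intro LBINT_iterated_eq_enn2real nonneg) auto
  then show ?thesis
    unfolding density using R_H_eq_nn_integral[of H t s] bounds by simp
qed

end

theorem proposition2p0p5:
  fixes H :: "real \<Rightarrow> real"
  assumes H_range: "H \<in> {0..} \<rightarrow> {1/2<..<1}"
    and H_meas: "H \<in> borel_measurable (restrict_space borel {0..})"
  shows
    "((\<forall>s\<ge>0. \<forall>t\<ge>0.
        R_H H t s = c_prod H t s *
          (beta_tilde H t s * (min s t powr (H t + H s) / (H t + H s)) +
           beta1 H (min s t) (max s t) *
             (LBINT y:{min s t..max s t}. LBINT z:{0..min s t}.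
                (y / z) powr ((H t - H s) * of_bool (s \<le> t) + (H s - H t) * of_bool (s > t)) *
                (y - z) powr (H t + H s - 2))))
     \<and> (\<forall>s t. 0 \<le> s \<and> s \<le> t \<longrightarrow>
        R_H H t s = c_prod H t s *
          (beta_tilde H t s * (s powr (H t + H s) / (H t + H s)) +
           beta1 H s t *
             (LBINT y:{s..t}. LBINT z:{0..s}.
                (y / z) powr (H t - H s) * (y - z) powr (H t + H s - 2)))))
     \<and> ((\<forall>s t. 0 \<le> s \<and> s \<le> t \<and> 0 < t \<longrightarrow>
        R_H H t s = c_prod H t s / (H t + H s) *
          (beta1 H t s * beta2 H t s * s powr (H t + H s) +
           beta1 H s t *
             (s powr (H t + H s) *
                (LBINT v:{s / t..1}. v powr (- 2 * H t) * (1 - v) powr (H s + H t - 2)) +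
              t powr (H t + H s) *
                (LBINT v:{0..s / t}. v powr (H s - H t) * (1 - v) powr (H s + H t - 2)))))
     \<and> (\<forall>t>0. R_H H t 0 = 0))
     \<and> (\<forall>s t. 0 < s \<and> s \<le> t \<longrightarrow>
        complex_of_real (R_H H t s) = complex_of_real (c_prod H t s / (H t + H s)) *
          (complex_of_real (beta1 H t s * beta2 H t s * s powr (H t + H s)) +
           complex_of_real (beta1 H s t * beta2 H s t * t powr (H t + H s)) +
           complex_of_real (beta1 H s t * t * (t - s) powr (H t + H s - 1) / (H t + H s - 1) *
               (t / s) powr (H t - H s)) *
             (hyp2F1 1 (complex_of_real (2 * H t)) (complex_of_real (H s + H t))
                (complex_of_real ((s - t) / s)) -
              hyp2F1 1 (complex_of_real (H t - H s)) (complex_of_real (H s + H t))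
                (complex_of_real ((s - t) / s)))))
     \<and> (\<forall>s\<ge>0. \<forall>t\<ge>0.
        R_H H t s = c_prod H t s *
          (LBINT y:{0..t}. LBINT z:{0..s}.
             (beta1 H s t * of_bool (y > z) + beta1 H t s * of_bool (y < z)) *
             (y / z) powr (H t - H s) * \<bar>y - z\<bar> powr (H s + H t - 2)))
     \<and> (\<forall>s t. 0 \<le> s \<and> s \<le> t \<longrightarrow>
        R_H H t s = c_prod H t s *
          (beta1 H t s * beta2 H t s / (H t + H s) * s powr (H t + H s) +
           beta1 H s t * beta2 H s t / (H t + H s) * t powr (H t + H s) -
           beta1 H s t *
             (LBINT z:{s..t}. LBINT y:{z..t}.
                (y / z) powr (H t - H s) * (y - z) powr (H s + H t - 2))))"
proof (intro conjI allI impI)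
  fix s t :: real
  assume s: "0 \<le> s" and t: "0 \<le> t"
  show "R_H H t s = c_prod H t s *
          (beta_tilde H t s * (min s t powr (H t + H s) / (H t + H s)) +
           beta1 H (min s t) (max s t) *
             (LBINT y:{min s t..max s t}. LBINT z:{0..min s t}.
                (y / z) powr ((H t - H s) * of_bool (s \<le> t) + (H s - H t) * of_bool (s > t)) *
                (y - z) powr (H t + H s - 2)))"
  proof (cases "s \<le> t")
    case True
    then show ?thesis
      using R_H_rectangle[OF H_range s True] by (simp add: min_absorb1 max_absorb2)
  next
    case False
    then have ts: "t \<le> s"
      by simp
    have "c_prod H t s = c_prod H s t" "beta_tilde H t s = beta_tilde H s t"
      by (simp_all add: c_prod_def beta_tilde_def)
    then show ?thesis
      using R_H_rectangle[OF H_range t ts] ts False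
      by (simp add: R_H_commute[of H t s] min_absorb2 max_absorb1 add.commute[of "H t" "H s"])
  qed
  show "R_H H t s = c_prod H t s *
          (LBINT y:{0..t}. LBINT z:{0..s}.
             (beta1 H s t * of_bool (y > z) + beta1 H t s * of_bool (y < z)) *
             (y / z) powr (H t - H s) * \<bar>y - z\<bar> powr (H s + H t - 2))"
    by (rule R_H_double_integral[OF H_range s t])
next
  fix s t :: real
  assume "0 \<le> s \<and> s \<le> t"
  then have st: "0 \<le> s" "s \<le> t"
    by auto
  show "R_H H t s = c_prod H t s *
          (beta_tilde H t s * (s powr (H t + H s) / (H t + H s)) +
           beta1 H s t *
             (LBINT y:{s..t}. LBINT z:{0..s}.
                (y / z) powr (H t - H s) * (y - z) powr (H t + H s - 2)))"
    by (rule R_H_rectangle[OF H_range st])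
  show "R_H H t s = c_prod H t s *
          (beta1 H t s * beta2 H t s / (H t + H s) * s powr (H t + H s) +
           beta1 H s t * beta2 H s t / (H t + H s) * t powr (H t + H s) -
           beta1 H s t *
             (LBINT z:{s..t}. LBINT y:{z..t}.
                (y / z) powr (H t - H s) * (y - z) powr (H s + H t - 2)))"
    by (rule R_H_triangle[OF H_range st])
next
  fix s t :: real
  assume "0 \<le> s \<and> s \<le> t \<and> 0 < t"
  then show "R_H H t s = c_prod H t s / (H t + H s) *
          (beta1 H t s * beta2 H t s * s powr (H t + H s) +
           beta1 H s t *
             (s powr (H t + H s) *
                (LBINT v:{s / t..1}. v powr (- 2 * H t) * (1 - v) powr (H s + H t - 2)) +
              t powr (H t + H s) *
                (LBINT v:{0..s / t}. v powr (H s - H t) * (1 - v) powr (H s + H t - 2))))"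
    by (intro R_H_incomplete_Beta[OF H_range]) auto
next
  fix t :: real
  assume "0 < t"
  then show "R_H H t 0 = 0"
    by (simp add: R_H_def LBINT_singleton)
next
  fix s t :: real
  assume "0 < s \<and> s \<le> t"
  then show "complex_of_real (R_H H t s) = complex_of_real (c_prod H t s / (H t + H s)) *
          (complex_of_real (beta1 H t s * beta2 H t s * s powr (H t + H s)) +
           complex_of_real (beta1 H s t * beta2 H s t * t powr (H t + H s)) +
           complex_of_real (beta1 H s t * t * (t - s) powr (H t + H s - 1) / (H t + H s - 1) *
               (t / s) powr (H t - H s)) *
             (hyp2F1 1 (complex_of_real (2 * H t)) (complex_of_real (H s + H t))
                (complex_of_real ((s - t) / s)) -
              hyp2F1 1 (complex_of_real (H t - H s)) (complex_of_real (H s + H t))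
                (complex_of_real ((s - t) / s))))"
    by (intro R_H_hypergeometric[OF H_range]) auto
qed

end
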